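(* Let $C$ and $\tilde{C}$ be complex analytic plane branches at $0\in\mathbb{C}^2$. If $C$ and $\tilde{C}$ have different sequences of characteristic exponents, then there exists $0<\alpha<1$ such that $(C,0)$ is not $\alpha$-Hölder homeomorphic to $(\tilde{C},0)$. In particular, $(C,0)$ and $(\tilde C,0)$ are not bi-Lipschitz homeomorphic.
   Context: $\mathbb{C}^2\cong\mathbb{R}^4$ carries the Euclidean norm. Hölder equivalence: for a real $\alpha>0$, a map $f\colon U\subset\mathbb{R}^n\to\mathbb{R}^m$ is $\alpha$-Hölder if there is $c>0$ with $\|f(p)-f(q)\|\le c\|p-q\|^{\alpha}$ for all $p,q\in U$. Germs $(X,x_0)$, $(Y,y_0)$ of Euclidean subsets are $\alpha$-Hölder homeomorphic if there is a germ of homeomorphism $f\colon(X,x_0)\to(Y,y_0)$ (so $f(x_0)=y_0$) such that $f$ and $f^{-1}$ are $\alpha$-Hölder; such an $f$ is called a bi-$\alpha$-Hölder homeomorphism. Bi-$1$-Hölder homeomorphisms are the bi-Lipschitz homeomorphisms. A complex analytic plane branch is a germ at $0\in\mathbb{C}^2$ of an analytically irreducible complex analytic curve. Characteristic exponents: after an analytic change of coordinates, a branch $C$ has a parametrization $x=t^n$, $y=a_1t^{m}+\cdots\in\mathbb{C}\{t\}$, where $n$ is the multiplicity of $C$ at $0$, $a_1\neq0$, and, if $C$ is singular at $0$, $n$ does not divide $m$. For $C$ singular put $\beta_0=n$, $\beta_1=m$, $e_1=\gcd(\beta_0,\beta_1)$; inductively, as long as $e_i>1$, let $\beta_{i+1}$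 be the smallest exponent appearing with nonzero coefficient in $y(t)$ that is not a multiple of $e_i$, and $e_{i+1}=\gcd(e_i,\beta_{i+1})$. Let $g$ be the index with $e_g=1$. The sequence $(\beta_0,\beta_1,\dots,\beta_g)$ is the sequence of characteristic exponents of $C$. For a smooth branch the sequence is $(1)$ (i.e. $\beta_0=1$, $g=0$). *)

theory Defs
  imports "HOL-Analysis.Analysis"
begin

section \<open>Hoelder equivalence of germs\<close>

definition holder_on :: "real \<Rightarrow> 'a::euclidean_space set \<Rightarrow> ('a \<Rightarrow> 'b::euclidean_space) \<Rightarrow> bool" where
  "holder_on \<alpha> U f \<longleftrightarrow>
     (\<exists>c>0. \<forall>p\<in>U. \<forall>q\<in>U. norm (f p - f q) \<le> c * norm (p - q) powr \<alpha>)"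

text \<open>
  Throughout, a germ is given by a set representing it together with its base point. All notions
  below depend only on the part of the set in an arbitrarily small neighbourhood of that point.
\<close>

definition holder_homeomorphic ::
    "real \<Rightarrow> 'a::euclidean_space set \<Rightarrow> 'a \<Rightarrow> 'b::euclidean_space set \<Rightarrow> 'b \<Rightarrow> bool" where
  "holder_homeomorphic \<alpha> X x\<^sub>0 Y y\<^sub>0 \<longleftrightarrow>
     (\<exists>U V f g. open U \<and> x\<^sub>0 \<in> U \<and> open V \<and> y\<^sub>0 \<in> V \<and>
        homeomorphism (X \<inter> U) (Y \<inter> V) f g \<and> f x\<^sub>0 = y\<^sub>0 \<and>
        holder_on \<alpha> (X \<inter> U) f \<and> holder_on \<alpha> (Y \<inter> V) g)"

definition bilipschitz_homeomorphic ::
    "'a::euclidean_space set \<Rightarrow> 'a \<Rightarrow> 'b::euclidean_space set \<Rightarrow> 'b \<Rightarrow> bool" where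
  "bilipschitz_homeomorphic X x\<^sub>0 Y y\<^sub>0 \<longleftrightarrow> holder_homeomorphic 1 X x\<^sub>0 Y y\<^sub>0"


section \<open>Holomorphic functions of two variables\<close>

text \<open>
  The product norm on \<^typ>\<open>complex \<times> complex\<close> is the Euclidean one. On open sets, holomorphy means
  that the real Frechet derivative exists and is complex linear.
\<close>

definition holomorphic2_on :: "(complex \<times> complex \<Rightarrow> complex) \<Rightarrow> (complex \<times> complex) set \<Rightarrow> bool"
    (infixl "holomorphic2'_on" 50) where
  "f holomorphic2_on U \<longleftrightarrow>
     (\<forall>z\<in>U. \<exists>a b. (f has_derivative (\<lambda>h. a * fst h + b * snd h)) (at z))"

definition holomorphic_germ2 :: "(complex \<times> complex \<Rightarrow> complex) \<Rightarrow> bool" where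
  "holomorphic_germ2 f \<longleftrightarrow> (\<exists>U. open U \<and> 0 \<in> U \<and> f holomorphic2_on U)"

text \<open>
  Irreducibility in the local ring of holomorphic germs at the origin, where the units are
  exactly the germs not vanishing at the origin.
\<close>

definition irreducible_germ2 :: "(complex \<times> complex \<Rightarrow> complex) \<Rightarrow> bool" where
  "irreducible_germ2 f \<longleftrightarrow>
     holomorphic_germ2 f \<and> \<not> (\<forall>\<^sub>F z in nhds 0. f z = 0) \<and> f 0 = 0 \<and>
     (\<forall>g h. holomorphic_germ2 g \<and> holomorphic_germ2 h \<and> (\<forall>\<^sub>F z in nhds 0. f z = g z * h z)
        \<longrightarrow> g 0 \<noteq> 0 \<or> h 0 \<noteq> 0)"

text \<open>The lowest-order nonzero homogeneous part of \<open>f\<close> at the origin has degree \<open>n\<close>.\<close>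

definition has_order2 :: "(complex \<times> complex \<Rightarrow> complex) \<Rightarrow> nat \<Rightarrow> bool" where
  "has_order2 f n \<longleftrightarrow>
     (\<exists>c K. (\<exists>i\<le>n. c i \<noteq> 0) \<and>
        (\<forall>\<^sub>F z in nhds 0.
           norm (f z - (\<Sum>i\<le>n. c i * fst z ^ i * snd z ^ (n - i))) \<le> K * norm z ^ Suc n))"

definition analytic_coordinate_change ::
    "(complex \<times> complex \<Rightarrow> complex \<times> complex) \<Rightarrow> (complex \<times> complex) set \<Rightarrow> bool" where
  "analytic_coordinate_change \<phi> U \<longleftrightarrow>
     (\<exists>V \<psi>. open U \<and> 0 \<in> U \<and> open V \<and> homeomorphism U V \<phi> \<psi> \<and> \<phi> 0 = 0 \<and>
        (fst \<circ> \<phi>) holomorphic2_on U \<and> (snd \<circ> \<phi>) holomorphic2_on U \<and>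
        (fst \<circ> \<psi>) holomorphic2_on V \<and> (snd \<circ> \<psi>) holomorphic2_on V)"


section \<open>Plane branches\<close>

definition branch_equation ::
    "(complex \<times> complex) set \<Rightarrow> (complex \<times> complex \<Rightarrow> complex) \<Rightarrow> bool" where
  "branch_equation C f \<longleftrightarrow> irreducible_germ2 f \<and> (\<forall>\<^sub>F z in nhds 0. z \<in> C \<longleftrightarrow> f z = 0)"

definition plane_branch :: "(complex \<times> complex) set \<Rightarrow> bool" where
  "plane_branch C \<longleftrightarrow> (\<exists>f. branch_equation C f)"

definition has_multiplicity :: "(complex \<times> complex) set \<Rightarrow> nat \<Rightarrow> bool" where
  "has_multiplicity C n \<longleftrightarrow> (\<exists>f. branch_equation C f \<and> has_order2 f n)"

text \<open>
  After an analytic change of coordinates, the germ of \<open>C\<close> is parametrized by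
  \<open>x = t ^ n\<close>, \<open>y = y(t)\<close>, where \<open>y\<close> is a convergent power series; the bound on \<open>r\<close> keeps
  \<open>t\<close> inside the disc of convergence, outside which \<^const>\<open>eval_fps\<close> carries no meaning.
\<close>

definition parametrized_by :: "(complex \<times> complex) set \<Rightarrow> nat \<Rightarrow> complex fps \<Rightarrow> bool" where
  "parametrized_by C n y \<longleftrightarrow>
     (\<exists>\<phi> U r. analytic_coordinate_change \<phi> U \<and> 0 < r \<and> ereal r \<le> fps_conv_radius y \<and>
        inj_on (\<lambda>t. (t ^ n, eval_fps y t)) (ball 0 r) \<and>
        \<phi> ` (C \<inter> U) = (\<lambda>t. (t ^ n, eval_fps y t)) ` ball 0 r)"


section \<open>Characteristic exponents\<close>

text \<open>
  \<open>further_exponents y e bs\<close>: if \<open>e\<close> is the current gcd \<open>e\<^sub>i\<close>, then \<open>bs\<close> lists the remaining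
  characteristic exponents \<open>\<beta>\<^bsub>i+1\<^esub>, \<dots>, \<beta>\<^sub>g\<close>; the process stops as soon as the gcd is 1.
\<close>

inductive further_exponents :: "complex fps \<Rightarrow> nat \<Rightarrow> nat list \<Rightarrow> bool"
  for y :: "complex fps" where
  stop: "further_exponents y 1 []"
| step: "further_exponents y e (b # bs)"
    if "e > 1"
      and "fps_nth y b \<noteq> 0" and "\<not> e dvd b"
      and "\<And>k. fps_nth y k \<noteq> 0 \<Longrightarrow> \<not> e dvd k \<Longrightarrow> b \<le> k"
      and "further_exponents y (gcd e b) bs"

text \<open>
  \<open>\<beta>\<close> is the sequence \<open>(\<beta>\<^sub>0, \<dots>, \<beta>\<^sub>g)\<close> of characteristic exponents of the branch \<open>C\<close>.
  The branch is smooth iff its multiplicity is 1. The exponent \<open>m\<close> of the leading term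
  of \<open>y\<close> is its \<^const>\<open>subdegree\<close>.
\<close>

definition characteristic_exponents :: "(complex \<times> complex) set \<Rightarrow> nat list \<Rightarrow> bool" where
  "characteristic_exponents C \<beta> \<longleftrightarrow>
     (\<exists>n y. has_multiplicity C n \<and> parametrized_by C n y \<and> y \<noteq> 0 \<and>
        (if n = 1 then \<beta> = [1]
         else \<not> n dvd subdegree y \<and>
           (\<exists>bs. further_exponents y (gcd n (subdegree y)) bs \<and> \<beta> = n # subdegree y # bs)))"

end

theory Submission imports Defs "HOL-Complex_Analysis.Complex_Analysis" begin

text \<open>
  For a branch \<open>x = t\<^sup>n, y = y(t)\<close> and \<open>q > 1\<close>, let \<open>G(q)\<close> be the gcd of \<open>n\<close> and of all exponents
  \<open>k < q n\<close> of \<open>y\<close>. The jumps of this step function are the \<open>\<beta>\<^sub>i / n\<close>, so \<open>G\<close> determines the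
  characteristic exponents. Over a point \<open>x\<close> with \<open>|x| = \<epsilon>\<^sup>n\<close>, the points with parameters
  \<open>\<zeta> \<epsilon>\<close>, \<open>\<zeta>\<^bsup>G(q)\<^esup> = 1\<close>, are at mutual distance \<open>O(|x|\<^bsup>q\<^esup>)\<close>, but no two of them can be joined by a connected
  set of diameter much smaller than \<open>|x|\<close>. A bi-\<open>\<alpha>\<close>-Hoelder map sends them to points of the second
  branch which are still at mutual distance \<open>O(|x'|\<^bsup>\<alpha>\<alpha>q\<^esup>)\<close>. If \<open>\<alpha>\<^sup>2 q > 1\<close>, they must
  lie on different sheets over the \<open>x\<close>-line, and these sheets have contact at least
  \<open>\<alpha>\<^sup>2 q\<close>, so there are at most \<open>G'(\<alpha>\<^sup>2 q)\<close> of them. Hence \<open>G(q) \<le> G'(\<alpha>\<^sup>2 q)\<close>, which equals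
  \<open>G'(q)\<close> when \<open>\<alpha>\<close> is close to 1 since \<open>G'\<close> is left continuous, and the roles of the branches
  can be exchanged.

  The argument needs \<open>n \<le> ord y\<close>. This follows from \<open>n\<close> being the multiplicity: the product of
  \<open>y - y(\<zeta> t)\<close> over \<open>\<zeta>\<^sup>n = 1\<close> divides any equation of the branch, and thus has order \<open>n\<close>
  if that equation is irreducible.
\<close>

section \<open>The gcd function of a branch\<close>

text \<open>Moreover it does not respect the projections to the x-line: conjugate points over one x
  are sent to points over different x'. The sheet of an image point therefore has to be named by
  moving it to a common x', and this needs y to be Lipschitz over x along a sheet, whence the
  condition n \<le> ord y. The exponent \<alpha>^2 appears twice, for separate reasons. One factor
  \<alpha> always comes from the mutual distances of the images. In the contact estimate the other
  comes from expressing |x| through |x'|; in the proof that sheets are distinct it comes from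
  pulling a path back by the inverse map, where \<alpha>^2 q > 1 makes the displacement small
  compared with |x|. Only q > 1 can be used. This loses nothing once y has no exponent below n: then
  G(q) = n for q slightly above 1, so the multiplicity is recovered too.\<close>

definition contact_gcd :: "nat \<Rightarrow> complex fps \<Rightarrow> real \<Rightarrow> nat" where
  "contact_gcd n y q = Gcd (insert n {k. fps_nth y k \<noteq> 0 \<and> real k < q * real n})"

lemma contact_gcd_dvd: "contact_gcd n y q dvd n"
  unfolding contact_gcd_def by (rule Gcd_dvd) simp

lemma contact_gcd_dvd_exponent:
  assumes "fps_nth y k \<noteq> 0" "real k < q * real n"
  shows "contact_gcd n y q dvd k"
  unfolding contact_gcd_def by (rule Gcd_dvd) (use assms in simp)

text \<open>The multiplicative order of \<eta> divides every k with \<eta>^k = 1, hence also the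
  gcd. With \<open>contact_gcd_dvd_exponent\<close> this identifies the n-th roots of unity that
  leave all terms of y of degree below q n unchanged: they are the roots of unity of order dividing
  \<open>contact_gcd n y q\<close>, so their number is the gcd itself.\<close>

lemma power_contact_gcd_eq_1:
  fixes \<eta> :: complex
  assumes "\<eta> ^ n = 1" and "\<And>k. fps_nth y k \<noteq> 0 \<Longrightarrow> real k < q * real n \<Longrightarrow> \<eta> ^ k = 1"
    and "n > 0"
  shows "\<eta> ^ contact_gcd n y q = 1"
proof -
  define d where "d = (LEAST k. k > 0 \<and> \<eta> ^ k = 1)"
  have d: "d > 0 \<and> \<eta> ^ d = 1"
    unfolding d_def by (rule LeastI[of _ n]) (use assms in auto)
  have dvd: "d dvd k" if "\<eta> ^ k = 1" for k
  proof -
    have "\<eta> ^ k = (\<eta> ^ d) ^ (k div d) * \<eta> ^ (k mod d)"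
      by (metis mult_div_mod_eq power_add power_mult)
    then have "\<eta> ^ (k mod d) = 1" using that d by simp
    moreover have "k mod d < d" using d by simp
    ultimately have "k mod d = 0"
      using not_less_Least[of "k mod d" "\<lambda>k. k > 0 \<and> \<eta> ^ k = 1"] by (auto simp: d_def)
    then show ?thesis by auto
  qed
  have "d dvd contact_gcd n y q"
    unfolding contact_gcd_def by (rule Gcd_greatest) (use assms dvd in auto)
  then show ?thesis using d by (auto simp: power_mult)
qed

text \<open>For each exponent k the strict bound k < q n persists for smaller values near q, and
  only finitely many k lie below q n. With a non-strict bound the function could jump when q is
  approached from the left.\<close>

lemma contact_gcd_left_continuous:
  assumes "n > 0"
  shows "\<forall>\<^sub>F x in at_left q. contact_gcd n y x = contact_gcd n y q"
proof -
  have "\<forall>\<^sub>F x in at_left q. real k < x * real n" if "real k < q * real n" for k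
  proof -
    have "real k / real n < q" using that assms by (simp add: field_simps)
    then have "\<forall>\<^sub>F x in at_left q. real k / real n < x"
      using order_tendstoD(1)[OF tendsto_ident_at] by blast
    then show ?thesis
      by eventually_elim (use assms in \<open>simp add: field_simps\<close>)
  qed
  moreover have "finite {k. real k < q * real n}"
    by (rule finite_subset[of _ "{..nat \<lceil>q * real n\<rceil>}"]) (auto, linarith)
  ultimately have "\<forall>\<^sub>F x in at_left q. \<forall>k\<in>{k. real k < q * real n}. real k < x * real n"
    by (intro eventually_ball_finite) auto
  moreover have "\<forall>\<^sub>F x in at_left q. x < q"
    by (simp add: eventually_at_filter)
  ultimately show ?thesis
  proof eventually_elim
    case (elim x)
    have "x * real n < q * real n" using elim(2) assms by simp
    then have "real k < x * real n \<longleftrightarrow> real k < q * real n" for k using elim(1) by force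
    then show ?case by (simp add: contact_gcd_def)
  qed
qed

text \<open>The gcds of the truncated supports determine the next exponent b: e divides all
  exponents below N exactly when N \<le> b. The hypothesis is stable under replacing e by
  \<open>gcd e b\<close>, which carries the induction.\<close>

lemma further_exponents_unique:
  assumes "further_exponents y e bs" "further_exponents y' e bs'"
    and "\<And>N. gcd e (Gcd {k. fps_nth y k \<noteq> 0 \<and> k < N}) = gcd e (Gcd {k. fps_nth y' k \<noteq> 0 \<and> k < N})"
  shows "bs = bs'"
  using assms
proof (induction arbitrary: bs' rule: further_exponents.induct)
  case stop
  then show ?case by (auto elim: further_exponents.cases)
next
  case (step e b bs)
  from step.prems(1) step.hyps(1) obtain b' cs where bs': "bs' = b' # cs"
    and b': "fps_nth y' b' \<noteq> 0" "\<not> e dvd b'" "\<And>k. fps_nth y' k \<noteq> 0 \<Longrightarrow> \<not> e dvd k \<Longrightarrow> b' \<le> k"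
    and cs: "further_exponents y' (gcd e b') cs"
    by (auto elim: further_exponents.cases)
  have least: "(\<forall>k\<in>{k. P k \<and> k < N}. R k) \<longleftrightarrow> N \<le> c"
    if "P c" "\<not> R c" "\<And>k. P k \<Longrightarrow> \<not> R k \<Longrightarrow> c \<le> k" for P R and c N :: nat
  proof
    assume "\<forall>k\<in>{k. P k \<and> k < N}. R k"
    then show "N \<le> c" using that(1,2) not_le by blast
  next
    assume "N \<le> c"
    then show "\<forall>k\<in>{k. P k \<and> k < N}. R k" using that(3) by fastforce
  qed
  have "N \<le> b \<longleftrightarrow> N \<le> b'" for N
  proof -
    have "N \<le> b \<longleftrightarrow> e dvd Gcd {k. fps_nth y k \<noteq> 0 \<and> k < N}"
      unfolding dvd_Gcd_iff by (rule sym, rule least) (fact step.hyps)+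
    also have "\<dots> \<longleftrightarrow> e dvd Gcd {k. fps_nth y' k \<noteq> 0 \<and> k < N}"
      by (simp only: gcd_nat.absorb_iff1 step.prems(2)[of N])
    also have "\<dots> \<longleftrightarrow> N \<le> b'"
      unfolding dvd_Gcd_iff by (rule least) (fact b')+
    finally show ?thesis .
  qed
  then have [simp]: "b' = b" using le_antisym order_refl by blast
  have "gcd (gcd e b) (Gcd {k. fps_nth y k \<noteq> 0 \<and> k < N}) =
        gcd (gcd e b) (Gcd {k. fps_nth y' k \<noteq> 0 \<and> k < N})" for N
    by (simp only: gcd.assoc gcd.left_commute[of e b] step.prems(2)[of N])
  then show ?case using step.IH cs bs' by simp
qed

text \<open>An integer cut-off N > n is the value q = N / n, so the gcd function on q > 1 supplies
  the truncated gcds that \<open>further_exponents_unique\<close> asks for; cut-offs N \<le> n see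
  no exponent at all. Values of q just above 1 recover n.\<close>

lemma characteristic_exponents_eqI:
  assumes "n > 0" "n' > 0" and "\<And>q. q > 1 \<Longrightarrow> contact_gcd n y q = contact_gcd n' y' q"
    and "\<And>k. fps_nth y k \<noteq> 0 \<Longrightarrow> n \<le> k" and "\<And>k. fps_nth y' k \<noteq> 0 \<Longrightarrow> n' \<le> k"
    and "further_exponents y n bs" "further_exponents y' n' bs'"
  shows "n # bs = n' # bs'"
proof -
  have near1: "contact_gcd m z q = m"
    if "m > 0" "\<And>k. fps_nth z k \<noteq> 0 \<Longrightarrow> m \<le> k" "q * real m < real m + 1" for m z q
  proof -
    have "{k. fps_nth z k \<noteq> 0 \<and> real k < q * real m} \<subseteq> {m}"
      using that(2,3) by (force simp: antisym)
    then have "insert m {k. fps_nth z k \<noteq> 0 \<and> real k < q * real m} = {m}" by auto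
    then show ?thesis unfolding contact_gcd_def by (simp only: Gcd_insert Gcd_empty gcd_0_right normalize_nat_def id_apply)
  qed
  \<comment> \<open>Chosen so that q n < n + 1 and q n' < n' + 1: the only exponent that either gcd
    can then see is n, respectively n'.\<close>
  define q where "q = 1 + 1 / (1 + real n + real n')"
  have "contact_gcd n y q = n" "contact_gcd n' y' q = n'"
    by (rule near1; use assms in \<open>simp add: q_def field_simps\<close>)+
  moreover have "q > 1" by (simp add: q_def)
  ultimately have [simp]: "n' = n" using assms(3) by metis
  have "gcd n (Gcd {k. fps_nth y k \<noteq> 0 \<and> k < N}) = gcd n (Gcd {k. fps_nth y' k \<noteq> 0 \<and> k < N})" for N
  proof (cases "N > n")
    case True
    have "contact_gcd n z (real N / real n) = gcd n (Gcd {k. fps_nth z k \<noteq> 0 \<and> k < N})" for z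
      using assms(1) by (simp add: contact_gcd_def)
    then show ?thesis using assms(3)[of "real N / real n"] assms(1) True by simp
  next
    case False
    then have "{k. fps_nth y k \<noteq> 0 \<and> k < N} = {}" "{k. fps_nth y' k \<noteq> 0 \<and> k < N} = {}"
      using assms(4,5) by force+
    then show ?thesis by (simp only:)
  qed
  then show ?thesis using further_exponents_unique[of y n bs y' bs'] assms(6,7) by simp
qed

section \<open>Puiseux series near the origin\<close>

text \<open>The holomorphic n-th root near 1 serves to name sheets: if t^n / s^n is close to 1, then
  t is \<omega> s times the root of t^n / s^n with \<omega>^n = 1, and \<omega> tells on which sheet
  t lies relative to s.\<close>

definition root_near_1 :: "nat \<Rightarrow> complex \<Rightarrow> complex" where
  "root_near_1 n w = exp (Ln w / of_nat n)"

lemma ball_1_half: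
  assumes "w \<in> ball (1::complex) (1/2)"
  shows "w \<noteq> 0" "w \<notin> \<real>\<^sub>\<le>\<^sub>0" "norm w > 1/2" "norm w < 2"
proof -
  have w: "norm (1 - w) < 1/2" using assms by (simp add: dist_norm)
  have "norm (1::complex) \<le> norm (1 - w) + norm w"
    using norm_triangle_ineq[of "1 - w" w] by simp
  then show "norm w > 1/2" using w by simp
  then show "w \<noteq> 0" by auto
  show "norm w < 2" using w norm_triangle_ineq[of "w - 1" 1] by (simp add: norm_minus_commute)
  have "\<bar>Re (1 - w)\<bar> < 1/2" using abs_Re_le_cmod[of "1 - w"] w by linarith
  then show "w \<notin> \<real>\<^sub>\<le>\<^sub>0" by (auto simp: complex_nonpos_Reals_iff)
qed

lemma root_near_1_power: "n > 0 \<Longrightarrow> w \<noteq> 0 \<Longrightarrow> root_near_1 n w ^ n = w"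
  by (simp add: root_near_1_def exp_of_nat_mult[symmetric])

lemma root_near_1_1 [simp]: "root_near_1 n 1 = 1"
  by (simp add: root_near_1_def)

lemma root_near_1_nonzero [simp]: "root_near_1 n w \<noteq> 0"
  by (simp add: root_near_1_def)

lemma norm_root_near_1_less:
  assumes "n > 0" "w \<in> ball 1 (1/2)"
  shows "norm (root_near_1 n w) < 2"
proof (rule ccontr)
  assume "\<not> norm (root_near_1 n w) < 2"
  then have "2 ^ n \<le> norm (root_near_1 n w) ^ n" by (intro power_mono) auto
  also have "\<dots> = norm w"
    using root_near_1_power[OF assms(1), of w] ball_1_half(1)[OF assms(2)] by (simp flip: norm_power)
  also have "\<dots> < 2" using ball_1_half(4)[OF assms(2)] .
  finally show False using assms(1) power_increasing[of 1 n "2::real"] by simp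
qed

lemma has_field_derivative_root_near_1:
  assumes "n > 0" "w \<in> ball 1 (1/2)"
  shows "(root_near_1 n has_field_derivative root_near_1 n w / (of_nat n * w)) (at w)"
  unfolding root_near_1_def[abs_def]
  using assms(1) ball_1_half(1,2)[OF assms(2)]
  by (auto intro!: derivative_eq_intros simp: field_simps)

lemma continuous_on_root_near_1: "n > 0 \<Longrightarrow> continuous_on (ball 1 (1/2)) (root_near_1 n)"
  by (meson has_field_derivative_root_near_1 DERIV_isCont continuous_at_imp_continuous_on)

text \<open>The derivative is root / (n w) with |root| < 2 and |w| > 1/2, which gives the constant 2
  / (1/2), independent of n.\<close>

lemma root_near_1_lipschitz:
  assumes "n > 0" "w \<in> ball 1 (1/2)" "w' \<in> ball 1 (1/2)"
  shows "norm (root_near_1 n w - root_near_1 n w') \<le> 4 * norm (w - w')"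
proof (rule field_differentiable_bound[of "ball 1 (1/2)" "root_near_1 n"
      "\<lambda>w. root_near_1 n w / (of_nat n * w)"])
  fix z :: complex assume z: "z \<in> ball 1 (1/2)"
  show "(root_near_1 n has_field_derivative root_near_1 n z / (of_nat n * z)) (at z within ball 1 (1/2))"
    using has_field_derivative_root_near_1[OF assms(1) z] by (rule has_field_derivative_at_within)
  have "1 / 2 \<le> real n * norm z"
    using mult_mono[of 1 "real n" "1/2" "norm z"] ball_1_half(3)[OF z] assms(1) by simp
  then have "norm (root_near_1 n z) / (real n * norm z) \<le> 2 / (1/2)"
    using norm_root_near_1_less[OF assms(1) z] by (intro frac_le) auto
  then show "norm (root_near_1 n z / (of_nat n * z)) \<le> 4"
    by (simp add: norm_divide norm_mult)
qed (use assms in auto)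

text \<open>Dividing the path by the root of t^n / x leaves a continuous path in the finite set of
  n-th roots of x, hence a constant one, and the divisor is 1 at both ends. The bound |x| / 2 keeps
  t^n / x in the disc where that root is continuous.\<close>

lemma nth_root_path_closed:
  fixes t :: "real \<Rightarrow> complex"
  assumes "n > 0" "continuous_on {0..1} t" "\<And>u. u \<in> {0..1} \<Longrightarrow> norm (t u ^ n - x) < norm x / 2"
    and "t 0 ^ n = x" "t 1 ^ n = x" "x \<noteq> 0"
  shows "t 0 = t 1"
proof -
  define \<mu> where "\<mu> u = t u / root_near_1 n (t u ^ n / x)" for u
  have B: "t u ^ n / x \<in> ball 1 (1/2)" if "u \<in> {0..1}" for u
  proof -
    have "norm (t u ^ n / x - 1) = norm (t u ^ n - x) / norm x"
      using assms(6) by (simp add: field_simps flip: norm_divide)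
    also have "\<dots> < 1/2" using assms(3)[OF that] assms(6) by (simp add: field_simps)
    finally show ?thesis by (simp add: dist_norm norm_minus_commute)
  qed
  have "continuous_on {0..1} (\<lambda>u. root_near_1 n (t u ^ n / x))"
    by (rule continuous_on_compose2[OF continuous_on_root_near_1])
      (use assms B in \<open>auto intro!: continuous_intros\<close>)
  then have "continuous_on {0..1} \<mu>"
    unfolding \<mu>_def by (intro continuous_intros assms(2)) auto
  moreover have "\<mu> ` {0..1} \<subseteq> {z. z ^ n = x}"
  proof clarify
    fix u :: real assume u: "u \<in> {0..1}"
    have "t u ^ n / x \<noteq> 0" using ball_1_half(1)[OF B[OF u]] .
    then show "\<mu> u ^ n = x"
      using assms(1,6) by (auto simp: \<mu>_def power_divide root_near_1_power)
  qed
  then have "finite (\<mu> ` {0..1})"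
    using finite_nth_roots[OF assms(1)] finite_subset by blast
  ultimately have "\<mu> constant_on {0..1}"
    by (intro continuous_finite_range_constant) auto
  then have "\<mu> 0 = \<mu> 1" by (auto simp: constant_on_def)
  then show ?thesis using assms by (simp add: \<mu>_def)
qed

section \<open>Growth of convergent power series at the origin\<close>

lemma has_fps_expansion_upper_bound:
  fixes f :: "complex \<Rightarrow> complex"
  assumes "f has_fps_expansion F" "\<And>k. k < m \<Longrightarrow> fps_nth F k = 0"
  obtains M d where "M > 0" "d > 0" "\<And>t. norm t < d \<Longrightarrow> norm (f t) \<le> M * norm t ^ m"
proof -
  define G where "G = fps_shift m F"
  have F: "F = G * fps_X ^ m"
    unfolding G_def by (rule fps_ext) (use assms(2) in \<open>auto simp: fps_X_power_mult_right_nth\<close>)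
  have r: "fps_conv_radius G > 0" using assms(1) by (simp add: G_def has_fps_expansion_def)
  have "isCont (eval_fps G) 0"
    using has_fps_expansion_imp_continuous[OF eval_fps_has_fps_expansion[OF r]] by simp
  then have "\<forall>\<^sub>F t in nhds 0. dist (eval_fps G t) (eval_fps G 0) < 1"
    unfolding isCont_def tendsto_at_iff_tendsto_nhds by (rule tendstoD) simp
  moreover have "\<forall>\<^sub>F t in nhds 0. f t = eval_fps F t"
    using assms(1) by (auto simp: has_fps_expansion_def eq_commute)
  moreover have "\<forall>\<^sub>F t in nhds 0. t \<in> eball (0::complex) (fps_conv_radius G)"
    using r by (intro eventually_nhds_in_open) (auto simp: zero_ereal_def)
  ultimately have "\<forall>\<^sub>F t in nhds 0. norm (f t) \<le> (norm (eval_fps G 0) + 1) * norm t ^ m"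
  proof eventually_elim
    case (elim t)
    have "eval_fps F t = eval_fps G t * t ^ m"
      unfolding F using elim(3) by (subst eval_fps_mult) (auto simp: fps_conv_radius_fps_X_power in_eball_iff)
    moreover have "norm (eval_fps G t) \<le> norm (eval_fps G 0) + 1"
      using elim(1) norm_triangle_ineq2[of "eval_fps G t" "eval_fps G 0"] by (simp add: dist_norm)
    ultimately show ?case by (simp add: elim(2) norm_mult norm_power mult_right_mono)
  qed
  then show thesis
    unfolding eventually_nhds_metric using that[of "norm (eval_fps G 0) + 1"]
    by (auto simp: add_nonneg_pos)
qed

lemma has_fps_expansion_lower_bound:
  fixes f :: "complex \<Rightarrow> complex"
  assumes "f has_fps_expansion F" "F \<noteq> 0"
  obtains c d where "c > 0" "d > 0" "\<And>t. norm t < d \<Longrightarrow> norm (f t) \<ge> c * norm t ^ subdegree F"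
proof -
  define m where "m = subdegree F"
  define G where "G = fps_shift m F"
  have F: "F = G * fps_X ^ m"
    unfolding G_def m_def by (rule subdegree_decompose)
  have r: "fps_conv_radius G > 0" using assms(1) by (simp add: G_def has_fps_expansion_def)
  have "isCont (eval_fps G) 0"
    using has_fps_expansion_imp_continuous[OF eval_fps_has_fps_expansion[OF r]] by simp
  moreover define g where "g = norm (eval_fps G 0)"
  have g: "g > 0" using assms(2) by (simp add: g_def eval_fps_at_0 G_def m_def)
  ultimately have "\<forall>\<^sub>F t in nhds 0. dist (eval_fps G t) (eval_fps G 0) < g / 2"
    unfolding isCont_def tendsto_at_iff_tendsto_nhds by (intro tendstoD) simp_all
  moreover have "\<forall>\<^sub>F t in nhds 0. f t = eval_fps F t"
    using assms(1) by (auto simp: has_fps_expansion_def eq_commute)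
  moreover have "\<forall>\<^sub>F t in nhds 0. t \<in> eball (0::complex) (fps_conv_radius G)"
    using r by (intro eventually_nhds_in_open) (auto simp: zero_ereal_def)
  ultimately have "\<forall>\<^sub>F t in nhds 0. norm (f t) \<ge> (g / 2) * norm t ^ m"
  proof eventually_elim
    case (elim t)
    have "eval_fps F t = eval_fps G t * t ^ m"
      unfolding F using elim(3) by (subst eval_fps_mult) (auto simp: fps_conv_radius_fps_X_power in_eball_iff)
    moreover have "norm (eval_fps G t) \<ge> g / 2"
      using elim(1) norm_triangle_ineq2[of "eval_fps G 0" "eval_fps G t"]
      unfolding g_def dist_norm by (simp add: norm_minus_commute)
    ultimately have "g / 2 * norm t ^ m \<le> norm (eval_fps G t) * norm t ^ m"
      by (intro mult_right_mono) auto
    then show ?case using \<open>eval_fps F t = _\<close> by (simp add: elim(2) norm_mult norm_power)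
  qed
  then show thesis
    unfolding eventually_nhds_metric using that[of "g / 2"] g by (auto simp: m_def)
qed

section \<open>Differences of conjugate values of y\<close>

lemma has_fps_expansion_rotate_diff:
  fixes y :: "complex fps"
  assumes "fps_conv_radius y > 0"
  shows "(\<lambda>t. eval_fps y (\<omega> * t) - eval_fps y (\<omega>' * t)) has_fps_expansion
           Abs_fps (\<lambda>k. (\<omega> ^ k - \<omega>' ^ k) * fps_nth y k)"
proof -
  have "(eval_fps y \<circ> (\<lambda>t. a * t)) has_fps_expansion Abs_fps (\<lambda>k. a ^ k * fps_nth y k)" for a
  proof -
    have "(\<lambda>t. a * t) has_fps_expansion fps_const a * fps_X" by (intro fps_expansion_intros)
    from has_fps_expansion_compose[OF eval_fps_has_fps_expansion[OF assms] this]
    show ?thesis by (simp add: fps_compose_linear)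
  qed
  from has_fps_expansion_diff[OF this[of \<omega>] this[of \<omega>']]
  have "(\<lambda>t. eval_fps y (\<omega> * t) - eval_fps y (\<omega>' * t)) has_fps_expansion
      (Abs_fps (\<lambda>k. \<omega> ^ k * fps_nth y k) - Abs_fps (\<lambda>k. \<omega>' ^ k * fps_nth y k))"
    by (simp add: o_def)
  also have "Abs_fps (\<lambda>k. \<omega> ^ k * fps_nth y k) - Abs_fps (\<lambda>k. \<omega>' ^ k * fps_nth y k) =
      Abs_fps (\<lambda>k. (\<omega> ^ k - \<omega>' ^ k) * fps_nth y k)"
    by (simp add: fps_eq_iff algebra_simps)
  finally show ?thesis .
qed

lemma powr_small:
  fixes a b A :: real
  assumes "a > 0" "b > 0" "A > 0"
  obtains d where "d > 0" "\<And>x. 0 < x \<Longrightarrow> x < d \<Longrightarrow> A * x powr a < b"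
proof (rule that[of "(b / A) powr (1 / a)"])
  fix x :: real assume x: "0 < x" "x < (b / A) powr (1 / a)"
  then have "x powr a < ((b / A) powr (1 / a)) powr a"
    using assms by (intro powr_less_mono2) auto
  then show "A * x powr a < b" using assms by (simp add: powr_powr field_simps)
qed (use assms in auto)

lemma conjugate_difference_upper_bound:
  fixes y :: "complex fps"
  assumes "fps_conv_radius y > 0" and "\<zeta> ^ contact_gcd n y q = 1" "\<zeta>' ^ contact_gcd n y q = 1" "q > 0"
  obtains M d where "M > 0" "d > 0"
    "\<And>t. 0 < norm t \<Longrightarrow> norm t < d \<Longrightarrow>
      norm (eval_fps y (\<zeta> * t) - eval_fps y (\<zeta>' * t)) \<le> M * norm t powr (q * real n)"
proof -
  \<comment> \<open>The least integer that is at least q n: an integer k is below m exactly when it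
    is below q n, and for |t| < 1 the integer power is at most the real one.\<close>
  define m where "m = nat \<lceil>q * real n\<rceil>"
  have coeff: "(\<zeta> ^ k - \<zeta>' ^ k) * fps_nth y k = 0" if "k < m" for k
  proof (cases "fps_nth y k = 0")
    case False
    have "real k < q * real n" using that unfolding m_def by linarith
    with False have "contact_gcd n y q dvd k" by (intro contact_gcd_dvd_exponent)
    then show ?thesis using assms(2,3) by (auto simp: power_mult)
  qed auto
  obtain M d where M: "M > 0" "d > 0"
    "\<And>t. norm t < d \<Longrightarrow> norm (eval_fps y (\<zeta> * t) - eval_fps y (\<zeta>' * t)) \<le> M * norm t ^ m"
    using has_fps_expansion_upper_bound[OF has_fps_expansion_rotate_diff[OF assms(1), of \<zeta> \<zeta>'], of m] coeff
    by auto
  show thesis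
  proof (rule that[of M "min d 1"])
    fix t :: complex assume t: "0 < norm t" "norm t < min d 1"
    have "norm t ^ m = norm t powr real m" using t by (simp add: powr_realpow)
    also have "\<dots> \<le> norm t powr (q * real n)"
      using t unfolding m_def by (intro powr_mono') (auto, linarith)
    finally have "M * norm t ^ m \<le> M * norm t powr (q * real n)" using M(1) by simp
    with M(3)[of t] t show "norm (eval_fps y (\<zeta> * t) - eval_fps y (\<zeta>' * t)) \<le> M * norm t powr (q * real n)"
      by simp
  qed (use M in auto)
qed

text \<open>Disagreement in one term of degree k < Q bounds the order of the difference by k, so the
  difference eventually dominates |t|^Q with any constant. \<open>A\<close> is left free so that it
  can be matched with the constant of an upper bound obtained elsewhere.\<close>

lemma conjugate_difference_lower_bound:
  fixes y :: "complex fps"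
  assumes "fps_conv_radius y > 0" and "fps_nth y k \<noteq> 0" "real k < Q" "\<omega> ^ k \<noteq> \<omega>' ^ k" "A > 0"
  obtains d where "d > 0"
    "\<And>t. 0 < norm t \<Longrightarrow> norm t < d \<Longrightarrow>
      A * norm t powr Q < norm (eval_fps y (\<omega> * t) - eval_fps y (\<omega>' * t))"
proof -
  define D where "D = Abs_fps (\<lambda>k. (\<omega> ^ k - \<omega>' ^ k) * fps_nth y k)"
  have "fps_nth D k \<noteq> 0" using assms by (simp add: D_def)
  then have D: "D \<noteq> 0" "subdegree D \<le> k" by (auto intro: subdegree_leI)
  obtain c d where c: "c > 0" "d > 0"
    "\<And>t. norm t < d \<Longrightarrow> norm (eval_fps y (\<omega> * t) - eval_fps y (\<omega>' * t)) \<ge> c * norm t ^ subdegree D"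
    using has_fps_expansion_lower_bound[OF has_fps_expansion_rotate_diff[OF assms(1), of \<omega> \<omega>', folded D_def] D(1)]
    by auto
  obtain d' where d': "d' > 0" "\<And>x. 0 < x \<Longrightarrow> x < d' \<Longrightarrow> A * x powr (Q - real (subdegree D)) < c"
    using powr_small[of "Q - real (subdegree D)" c A] assms D(2) c(1) by auto
  show thesis
  proof (rule that[of "min d d'"])
    fix t :: complex assume t: "0 < norm t" "norm t < min d d'"
    have "A * norm t powr Q = (A * norm t powr (Q - real (subdegree D))) * norm t ^ subdegree D"
      using t powr_add[of "norm t" "Q - real (subdegree D)" "real (subdegree D)"] by (simp add: powr_realpow)
    also have "\<dots> < c * norm t ^ subdegree D"
      using d'(2)[of "norm t"] t by (intro mult_strict_right_mono) auto
    also have "\<dots> \<le> norm (eval_fps y (\<omega> * t) - eval_fps y (\<omega>' * t))" using c(3)[of t] t by simp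
    finally show "A * norm t powr Q < norm (eval_fps y (\<omega> * t) - eval_fps y (\<omega>' * t))" .
  qed (use c d' in auto)
qed

text \<open>Along one sheet y is Lipschitz as a function of x: |s|^n |w - w'| is the difference of
  the x-coordinates of the two points. The reason is that the derivative of y is O(|t|^(n-1)), which
  is where n \<le> ord y enters, while the two parameters differ by at most 4 |s| |w - w'|.\<close>

lemma eval_fps_sector_lipschitz:
  fixes y :: "complex fps"
  assumes "fps_conv_radius y > 0" "n > 0" "\<And>k. fps_nth y k \<noteq> 0 \<Longrightarrow> n \<le> k"
  obtains K d where "K > 0" "d > 0"
    "\<And>s w w'. norm s < d \<Longrightarrow> w \<in> ball 1 (1/2) \<Longrightarrow> w' \<in> ball 1 (1/2) \<Longrightarrow>
      norm (eval_fps y (s * root_near_1 n w) - eval_fps y (s * root_near_1 n w'))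
        \<le> K * norm s ^ n * norm (w - w')"
proof -
  have expn: "eval_fps (fps_deriv y) has_fps_expansion fps_deriv y"
    using assms(1) fps_conv_radius_deriv[of y] by (intro eval_fps_has_fps_expansion) (auto intro: less_le_trans)
  have "fps_nth (fps_deriv y) k = 0" if "k < n - 1" for k
    using assms(3)[of "Suc k"] that by auto
  then obtain M d where M: "M > 0" "d > 0"
    "\<And>t. norm t < d \<Longrightarrow> norm (eval_fps (fps_deriv y) t) \<le> M * norm t ^ (n - 1)"
    using has_fps_expansion_upper_bound[OF expn, where m = "n - 1"] by metis
  obtain r where r: "r > 0" "ereal r < fps_conv_radius y"
    using assms(1) ereal_dense2[of 0 "fps_conv_radius y"] by (auto simp: zero_ereal_def)
  show thesis
  \<comment> \<open>The parameters have modulus at most 2 |s|, hence the halved radius and the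
    factor 2^(n-1); the 4 is the Lipschitz constant of the root.\<close>
  proof (rule that[of "4 * M * 2 ^ (n - 1)" "min d r / 2"])
    fix s w w' :: complex assume s: "norm s < min d r / 2" and w: "w \<in> ball 1 (1/2)" "w' \<in> ball 1 (1/2)"
    have in_disc: "norm (s * root_near_1 n v) \<le> 2 * norm s" if "v \<in> ball 1 (1/2)" for v
      using mult_left_mono[OF less_imp_le[OF norm_root_near_1_less[OF assms(2) that]], of "norm s"]
      by (simp add: norm_mult mult.commute)
    have root_diff: "norm (s * root_near_1 n w - s * root_near_1 n w') \<le> norm s * (4 * norm (w - w'))"
      using mult_left_mono[OF root_near_1_lipschitz[OF assms(2) w], of "norm s"]
      by (simp add: norm_mult flip: right_diff_distrib)
    have "norm (eval_fps y (s * root_near_1 n w) - eval_fps y (s * root_near_1 n w'))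
        \<le> (M * (2 * norm s) ^ (n - 1)) * norm (s * root_near_1 n w - s * root_near_1 n w')"
    proof (rule field_differentiable_bound[of "cball 0 (2 * norm s)" _ "eval_fps (fps_deriv y)"])
      fix z :: complex assume z: "z \<in> cball 0 (2 * norm s)"
      have "norm z < r" using z s by simp
      then have "ereal (norm z) < fps_conv_radius y" using less_trans[OF _ r(2), of "ereal (norm z)"] by simp
      then show "(eval_fps y has_field_derivative eval_fps (fps_deriv y) z) (at z within cball 0 (2 * norm s))"
        by (rule has_field_derivative_eval_fps)
      have "norm (eval_fps (fps_deriv y) z) \<le> M * norm z ^ (n - 1)" using z s by (intro M) auto
      also have "\<dots> \<le> M * (2 * norm s) ^ (n - 1)"
        using z M(1) by (intro mult_left_mono power_mono) auto
      finally show "norm (eval_fps (fps_deriv y) z) \<le> M * (2 * norm s) ^ (n - 1)" .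
    qed (use in_disc w in auto)
    also have "\<dots> \<le> (M * (2 * norm s) ^ (n - 1)) * (norm s * (4 * norm (w - w')))"
      using root_diff M(1) by (intro mult_left_mono) auto
    also have "\<dots> = 4 * M * 2 ^ (n - 1) * norm s ^ n * norm (w - w')"
      using assms(2) by (cases n) (auto simp: power_mult_distrib algebra_simps)
    finally show "norm (eval_fps y (s * root_near_1 n w) - eval_fps y (s * root_near_1 n w'))
        \<le> 4 * M * 2 ^ (n - 1) * norm s ^ n * norm (w - w')" .
  qed (use M r in auto)
qed

section \<open>Images of conjugate points under a Hoelder map\<close>

text \<open>The sum-norm distance in the plane between the points with parameters t and s. Working
  with it on parameters separates the estimates from the analytic change of coordinates, which is
  locally bi-Lipschitz.\<close>

definition branch_dist :: "nat \<Rightarrow> complex fps \<Rightarrow> complex \<Rightarrow> complex \<Rightarrow> real" where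
  "branch_dist n y t s = norm (t ^ n - s ^ n) + norm (eval_fps y t - eval_fps y s)"

lemma branch_dist_nonneg: "branch_dist n y t s \<ge> 0"
  by (simp add: branch_dist_def)

lemma branch_dist_triangle: "branch_dist n y t u \<le> branch_dist n y t s + branch_dist n y s u"
  unfolding branch_dist_def
  using norm_triangle_ineq[of "t ^ n - s ^ n" "s ^ n - u ^ n"]
    norm_triangle_ineq[of "eval_fps y t - eval_fps y s" "eval_fps y s - eval_fps y u"] by simp

lemma branch_dist_commute: "branch_dist n y t s = branch_dist n y s t"
  by (simp add: branch_dist_def norm_minus_commute)

lemma norm_power_le_branch_dist_0: "n > 0 \<Longrightarrow> norm t ^ n \<le> branch_dist n y t 0"
  by (simp add: branch_dist_def norm_power zero_power)

text \<open>Together with \<open>norm_power_le_branch_dist_0\<close>: the distance to the origin is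
  comparable with |t|^n = |x|, because the order of y is not smaller than n.\<close>

lemma branch_dist_0_upper_bound:
  assumes "fps_conv_radius y > 0" "n > 0" "\<And>k. fps_nth y k \<noteq> 0 \<Longrightarrow> n \<le> k"
  obtains A d where "A > 0" "d > 0" "\<And>t. norm t < d \<Longrightarrow> branch_dist n y t 0 \<le> A * norm t ^ n"
proof -
  have expn: "eval_fps y has_fps_expansion y" using assms(1) by (rule eval_fps_has_fps_expansion)
  have "fps_nth y k = 0" if "k < n" for k using assms(3)[of k] that by auto
  then obtain M d where M: "M > 0" "d > 0" "\<And>t. norm t < d \<Longrightarrow> norm (eval_fps y t) \<le> M * norm t ^ n"
    using has_fps_expansion_upper_bound[OF expn, where m = n] by metis
  have "eval_fps y 0 = 0" using assms(2) assms(3)[of 0] by (auto simp: eval_fps_at_0)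
  then have "branch_dist n y t 0 \<le> (M + 1) * norm t ^ n" if "norm t < d" for t
    using M(3)[OF that] assms(2) by (simp add: branch_dist_def norm_power zero_power distrib_right)
  then show thesis using M by (intro that[of "M + 1" d]) auto
qed

lemma eventually_at_0_iff:
  "(\<forall>\<^sub>F t in at (0::complex). P t) \<longleftrightarrow> (\<exists>d>0. \<forall>t. 0 < norm t \<and> norm t < d \<longrightarrow> P t)"
  by (auto simp: eventually_at)

text \<open>\<open>h\<close> and \<open>k\<close> are a Hoelder map and its inverse read in the
  parameters. A root of unity \<zeta> in \<open>R\<close> is sent to the label \<omega>(\<zeta>) of
  the sheet that contains h(\<zeta> \<epsilon>), relative to h(\<epsilon>). This is an injection
  into the roots of unity \<open>R''\<close> of the second branch, and comparing cardinalities gives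
  the claim.\<close>

lemma contact_gcd_le:
  fixes y y' :: "complex fps" and h k :: "complex \<Rightarrow> complex"
  assumes y: "fps_conv_radius y > 0" "n > 0" "\<And>k. fps_nth y k \<noteq> 0 \<Longrightarrow> n \<le> k"
    and y': "fps_conv_radius y' > 0" "n' > 0" "\<And>k. fps_nth y' k \<noteq> 0 \<Longrightarrow> n' \<le> k"
    and \<alpha>: "\<alpha> > 0" "\<alpha>\<^sup>2 * q > 1" and \<delta>: "\<delta> > 0" and c: "c > 0"
    and h: "\<And>t s. t \<in> ball 0 \<delta> \<Longrightarrow> s \<in> ball 0 \<delta> \<Longrightarrow>
      branch_dist n' y' (h t) (h s) \<le> c * branch_dist n y t s powr \<alpha>"
    and k: "\<And>t s. t \<in> ball 0 \<delta> \<Longrightarrow> s \<in> ball 0 \<delta> \<Longrightarrow>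
      branch_dist n y (k t) (k s) \<le> c * branch_dist n' y' t s powr \<alpha>"
    and 0: "h 0 = 0" "k 0 = 0" and contk: "continuous_on (ball 0 \<delta>) k"
    and kh: "\<And>t. t \<in> ball 0 \<delta> \<Longrightarrow> h t \<in> ball 0 \<delta> \<Longrightarrow> k (h t) = t"
  shows "contact_gcd n y q \<le> contact_gcd n' y' (\<alpha>\<^sup>2 * q)"
proof -
  define Q where "Q = \<alpha>\<^sup>2 * q"
  define e where "e = contact_gcd n y q"
  define e' where "e' = contact_gcd n' y' Q"
  define R where "R = {\<zeta>::complex. \<zeta> ^ e = 1}"
  define R' where "R' = {\<omega>::complex. \<omega> ^ n' = 1}"
  define R'' where "R'' = {\<omega>::complex. \<omega> ^ e' = 1}"
  have Q: "Q > 1" using \<alpha> by (simp add: Q_def)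
  have q: "q > 0"
    using \<alpha> zero_less_mult_pos[of "\<alpha>\<^sup>2" q] by simp
  have "e dvd n" "e' dvd n'" unfolding e_def e'_def by (rule contact_gcd_dvd)+
  then have e: "e > 0" "e' > 0" using y(2) y'(2) by (auto intro!: Nat.gr0I)
  have fin: "finite R" "finite R'" "finite R''"
    using e y'(2) by (simp_all add: R_def R'_def R''_def finite_roots_unity)
  have card: "card R = e" "card R'' = e'"
    using e by (simp_all add: R_def R''_def card_roots_unity_eq)
  have R1: "1 \<in> R" by (simp add: R_def)
  have Rn: "\<zeta> ^ n = 1" if "\<zeta> \<in> R" for \<zeta>
    using that \<open>e dvd n\<close> by (auto simp: R_def power_mult)
  have normR: "norm \<zeta> = 1" if "\<zeta> \<in> R" for \<zeta>
    using Rn[OF that] y(2) power_eq_1_iff[of \<zeta> n] by auto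

  have "\<forall>\<zeta>\<in>R. \<exists>M. M > 0 \<and> (\<forall>\<^sub>F t in at 0. norm (eval_fps y (\<zeta> * t) - eval_fps y (1 * t)) \<le> M * norm t powr (q * real n))"
  proof
    fix \<zeta> assume "\<zeta> \<in> R"
    then have "\<zeta> ^ contact_gcd n y q = 1" by (simp add: R_def e_def)
    then obtain M d where "M > 0" "d > 0" "\<And>t. 0 < norm t \<Longrightarrow> norm t < d \<Longrightarrow>
      norm (eval_fps y (\<zeta> * t) - eval_fps y (1 * t)) \<le> M * norm t powr (q * real n)"
      using conjugate_difference_upper_bound[OF y(1) _ _ q, of \<zeta> n 1] by auto
    then show "\<exists>M. M > 0 \<and> (\<forall>\<^sub>F t in at 0. norm (eval_fps y (\<zeta> * t) - eval_fps y (1 * t)) \<le> M * norm t powr (q * real n))"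
      unfolding eventually_at_0_iff by blast
  qed
  then obtain M where M: "\<And>\<zeta>. \<zeta> \<in> R \<Longrightarrow> M \<zeta> > 0"
      "\<And>\<zeta>. \<zeta> \<in> R \<Longrightarrow> \<forall>\<^sub>F t in at 0. norm (eval_fps y (\<zeta> * t) - eval_fps y (1 * t)) \<le> M \<zeta> * norm t powr (q * real n)"
    by metis
  define A1 where "A1 = sum M R"
  have A1: "A1 > 0" unfolding A1_def using fin R1 M(1) by (intro sum_pos) auto
  have "\<forall>\<^sub>F t in at 0. \<forall>\<zeta>\<in>R. norm (eval_fps y (\<zeta> * t) - eval_fps y (1 * t)) \<le> M \<zeta> * norm t powr (q * real n)"
    using M(2) fin by (intro eventually_ball_finite) auto
  then obtain d1 where d1: "d1 > 0" "\<And>t \<zeta>. 0 < norm t \<Longrightarrow> norm t < d1 \<Longrightarrow> \<zeta> \<in> R \<Longrightarrow>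
      norm (eval_fps y (\<zeta> * t) - eval_fps y t) \<le> M \<zeta> * norm t powr (q * real n)"
    unfolding eventually_at_0_iff by auto
  have MA1: "M \<zeta> \<le> A1" if "\<zeta> \<in> R" for \<zeta>
    unfolding A1_def using fin M(1) that by (intro member_le_sum) (auto intro: less_imp_le)

  obtain A3 d3 where A3: "A3 > 0" "d3 > 0" "\<And>t. norm t < d3 \<Longrightarrow> branch_dist n y t 0 \<le> A3 * norm t ^ n"
    using branch_dist_0_upper_bound[OF y] by blast
  obtain A3' d3' where A3': "A3' > 0" "d3' > 0" "\<And>t. norm t < d3' \<Longrightarrow> branch_dist n' y' t 0 \<le> A3' * norm t ^ n'"
    using branch_dist_0_upper_bound[OF y'] by blast
  obtain K dK where K: "K > 0" "dK > 0"
    "\<And>s w w'. norm s < dK \<Longrightarrow> w \<in> ball 1 (1/2) \<Longrightarrow> w' \<in> ball 1 (1/2) \<Longrightarrow>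
      norm (eval_fps y' (s * root_near_1 n' w) - eval_fps y' (s * root_near_1 n' w'))
        \<le> K * norm s ^ n' * norm (w - w')"
    using eval_fps_sector_lipschitz[OF y'] by blast
  \<comment> \<open>Constants of the estimates below: \<open>A2\<close> for the mutual distances of
    the images, \<open>A4\<close> for their size, \<open>A6\<close> for |x| in terms of |x'|,
    \<open>A8\<close> for the mutual distances in terms of |x'|.\<close>
  define A2 where "A2 = c * A1 powr \<alpha>"
  define A4 where "A4 = c * A3 powr \<alpha>"
  define A6 where "A6 = c * A3' powr \<alpha>"
  define A8 where "A8 = A2 * A6 powr (q * \<alpha>)"
  have A: "A2 > 0" "A4 > 0" "A6 > 0" "A8 > 0"
    using A1 A3 A3' c by (simp_all add: A2_def A4_def A6_def A8_def)

  \<comment> \<open>\<open>(K + 1) * A8\<close> is the constant of the upper bound that holds for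
    every sheet actually hit; a sheet of contact below Q has to violate it.\<close>
  have "\<forall>\<^sub>F s in at 0. \<forall>\<omega>\<in>R'. (\<exists>j. fps_nth y' j \<noteq> 0 \<and> real j < Q * real n' \<and> \<omega> ^ j \<noteq> 1) \<longrightarrow>
      ((K + 1) * A8) * norm s powr (Q * real n') < norm (eval_fps y' (\<omega> * s) - eval_fps y' (1 * s))"
  proof (intro eventually_ball_finite fin ballI)
    fix \<omega> assume "\<omega> \<in> R'"
    show "\<forall>\<^sub>F s in at 0. (\<exists>j. fps_nth y' j \<noteq> 0 \<and> real j < Q * real n' \<and> \<omega> ^ j \<noteq> 1) \<longrightarrow>
      ((K + 1) * A8) * norm s powr (Q * real n') < norm (eval_fps y' (\<omega> * s) - eval_fps y' (1 * s))"
    proof (cases "\<exists>j. fps_nth y' j \<noteq> 0 \<and> real j < Q * real n' \<and> \<omega> ^ j \<noteq> 1")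
      case True
      then obtain j where j: "fps_nth y' j \<noteq> 0" "real j < Q * real n'" "\<omega> ^ j \<noteq> 1 ^ j" by auto
      obtain d where "d > 0" "\<And>s. 0 < norm s \<Longrightarrow> norm s < d \<Longrightarrow>
        ((K + 1) * A8) * norm s powr (Q * real n') < norm (eval_fps y' (\<omega> * s) - eval_fps y' (1 * s))"
        using conjugate_difference_lower_bound[OF y'(1) j, of "(K + 1) * A8"] K A by auto
      then show ?thesis unfolding eventually_at_0_iff by blast
    next
      case False
      then show ?thesis by (intro always_eventually) blast
    qed
  qed
  then obtain d4 where d4: "d4 > 0" "\<And>s \<omega> j. 0 < norm s \<Longrightarrow> norm s < d4 \<Longrightarrow> \<omega> \<in> R' \<Longrightarrow>
      fps_nth y' j \<noteq> 0 \<Longrightarrow> real j < Q * real n' \<Longrightarrow> \<omega> ^ j \<noteq> 1 \<Longrightarrow>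
      ((K + 1) * A8) * norm s powr (Q * real n') < norm (eval_fps y' (\<omega> * s) - eval_fps y' s)"
    unfolding eventually_at_0_iff by auto
  \<comment> \<open>Keeps the ratios of the x'-coordinates of the images within 1/2 of 1; possible
    because Q > 1.\<close>
  obtain d5 where d5: "d5 > 0" "\<And>x. 0 < x \<Longrightarrow> x < d5 \<Longrightarrow> A8 * x powr ((Q - 1) * real n') < 1/2"
    using powr_small[of "(Q - 1) * real n'" "1/2" A8] Q y'(2) A by auto
  \<comment> \<open>\<open>\<delta> / 2\<close> because the path drawn later on a sheet passes
    through parameters of modulus up to nearly 2 \<rho>.\<close>
  define \<rho>0 where "\<rho>0 = Min {d3', dK, d4, d5, \<delta> / 2}"
  have \<rho>0: "\<rho>0 > 0" "\<rho>0 \<le> d3'" "\<rho>0 \<le> dK" "\<rho>0 \<le> d4" "\<rho>0 \<le> d5" "\<rho>0 \<le> \<delta> / 2"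
    using A3' K d4 d5 \<delta> unfolding \<rho>0_def by simp_all
  obtain d6 where d6: "d6 > 0" "\<And>x. 0 < x \<Longrightarrow> x < d6 \<Longrightarrow> A4 * x powr (real n * \<alpha>) < \<rho>0 ^ n'"
    using powr_small[of "real n * \<alpha>" "\<rho>0 ^ n'" A4] \<alpha> y(2) A \<rho>0(1) by auto
  \<comment> \<open>Constant for the displacement of x along the pulled-back path; the bound 1/2
    imposed on it is the one that \<open>nth_root_path_closed\<close> requires.\<close>
  define A9 where "A9 = c * ((K + 1) * (2 * A2)) powr \<alpha>"
  have A9: "A9 > 0" using c K A by (simp add: A9_def)
  obtain d7 where d7: "d7 > 0" "\<And>x. 0 < x \<Longrightarrow> x < d7 \<Longrightarrow> A9 * x powr ((Q - 1) * real n) < 1/2"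
    using powr_small[of "(Q - 1) * real n" "1/2" A9] Q y(2) A9 by auto
  define \<epsilon> where "\<epsilon> = Min {d1, d3, d6, d7, \<delta>} / 2"
  have \<epsilon>: "\<epsilon> > 0" "\<epsilon> < d1" "\<epsilon> < d3" "\<epsilon> < d6" "\<epsilon> < d7" "\<epsilon> < \<delta>"
  proof -
    have "Min {d1, d3, d6, d7, \<delta>} > 0" using d1 A3 d6 d7 \<delta> by simp
    then show "\<epsilon> > 0" "\<epsilon> < d1" "\<epsilon> < d3" "\<epsilon> < d6" "\<epsilon> < d7" "\<epsilon> < \<delta>"
      using Min_le[of "{d1, d3, d6, d7, \<delta>}"] unfolding \<epsilon>_def by fastforce+
  qed

  define p where "p \<zeta> = \<zeta> * of_real \<epsilon>" for \<zeta> :: complex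
  define s where "s \<zeta> = h (p \<zeta>)" for \<zeta>
  have p: "norm (p \<zeta>) = \<epsilon>" "p \<zeta> \<in> ball 0 \<delta>" "p \<zeta> ^ n = of_real \<epsilon> ^ n" if "\<zeta> \<in> R" for \<zeta>
    using that normR[OF that] Rn[OF that] \<epsilon> by (simp_all add: p_def norm_mult power_mult_distrib)
  have p_dist: "branch_dist n y (p \<zeta>) (p 1) \<le> A1 * \<epsilon> powr (q * real n)" if "\<zeta> \<in> R" for \<zeta>
  proof -
    have "branch_dist n y (p \<zeta>) (p 1) = norm (eval_fps y (\<zeta> * of_real \<epsilon>) - eval_fps y (of_real \<epsilon>))"
      using p(3)[OF that] p(3)[OF R1] by (simp add: branch_dist_def) (simp add: p_def)
    also have "\<dots> \<le> M \<zeta> * \<epsilon> powr (q * real n)" using d1(2)[of "of_real \<epsilon>" \<zeta>] \<epsilon> that by simp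
    also have "\<dots> \<le> A1 * \<epsilon> powr (q * real n)" using MA1[OF that] by (intro mult_right_mono) auto
    finally show ?thesis .
  qed
  have s_dist: "branch_dist n' y' (s \<zeta>) (s 1) \<le> A2 * \<epsilon> powr (q * real n * \<alpha>)" if "\<zeta> \<in> R" for \<zeta>
  proof -
    have "branch_dist n' y' (s \<zeta>) (s 1) \<le> c * branch_dist n y (p \<zeta>) (p 1) powr \<alpha>"
      unfolding s_def by (intro h p that R1)
    also have "\<dots> \<le> c * (A1 * \<epsilon> powr (q * real n)) powr \<alpha>"
      using c \<alpha> p_dist[OF that] by (intro mult_left_mono powr_mono2) (auto simp: branch_dist_nonneg)
    also have "\<dots> = A2 * \<epsilon> powr (q * real n * \<alpha>)"
      using A1 \<epsilon> by (simp add: powr_mult powr_powr A2_def)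
    finally show ?thesis .
  qed
  have s_small: "norm (s \<zeta>) < \<rho>0" if "\<zeta> \<in> R" for \<zeta>
  proof (rule power_less_imp_less_base[of _ n'])
    have "norm (s \<zeta>) ^ n' \<le> branch_dist n' y' (h (p \<zeta>)) (h 0)"
      unfolding s_def 0 by (intro norm_power_le_branch_dist_0 y')
    also have "\<dots> \<le> c * branch_dist n y (p \<zeta>) 0 powr \<alpha>"
      using \<delta> by (intro h p that) auto
    also have "\<dots> \<le> c * (A3 * \<epsilon> ^ n) powr \<alpha>"
      using c \<alpha> A3(3)[of "p \<zeta>"] p(1)[OF that] \<epsilon>
      by (intro mult_left_mono powr_mono2) (auto simp: branch_dist_nonneg)
    also have "\<dots> = A4 * \<epsilon> powr (real n * \<alpha>)"
      using A3 \<epsilon> by (simp add: powr_mult powr_powr A4_def flip: powr_realpow)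
    also have "\<dots> < \<rho>0 ^ n'" using d6 \<epsilon> by simp
    finally show "norm (s \<zeta>) ^ n' < \<rho>0 ^ n'" .
  qed (use \<rho>0 in auto)
  have s_ball: "s \<zeta> \<in> ball 0 \<delta>" if "\<zeta> \<in> R" for \<zeta>
    using s_small[OF that] \<rho>0 by auto
  have ks: "k (s \<zeta>) = p \<zeta>" if "\<zeta> \<in> R" for \<zeta>
    using s_ball[OF that] p[OF that] unfolding s_def by (intro kh) auto
  define \<rho> where "\<rho> = norm (s 1)"
  have "s 1 \<noteq> 0"
  proof
    assume "s 1 = 0"
    then have "p 1 = 0" using ks[OF R1] 0 by simp
    then show False using \<epsilon> by (simp add: p_def)
  qed
  then have \<rho>: "\<rho> > 0" "\<rho> < \<rho>0" using s_small[OF R1] by (auto simp: \<rho>_def)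
  \<comment> \<open>The inverse map \<open>k\<close> bounds the source point by its image. This
    turns powers of \<epsilon> into powers of \<rho> and costs the second factor \<alpha>.\<close>
  have \<epsilon>\<rho>: "\<epsilon> ^ n \<le> A6 * \<rho> powr (real n' * \<alpha>)"
  proof -
    have "\<epsilon> ^ n \<le> branch_dist n y (k (s 1)) (k 0)"
      using norm_power_le_branch_dist_0[OF y(2), of "p 1" y] p(1)[OF R1] ks[OF R1] 0 by simp
    also have "\<dots> \<le> c * branch_dist n' y' (s 1) 0 powr \<alpha>"
      using \<delta> s_ball R1 by (intro k) auto
    also have "\<dots> \<le> c * (A3' * \<rho> ^ n') powr \<alpha>"
      using c \<alpha> A3'(3)[of "s 1"] \<rho> \<rho>0
      by (intro mult_left_mono powr_mono2) (auto simp: branch_dist_nonneg \<rho>_def)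
    also have "\<dots> = A6 * \<rho> powr (real n' * \<alpha>)"
      using A3' \<rho> by (simp add: powr_mult powr_powr A6_def flip: powr_realpow)
    finally show ?thesis .
  qed
  have s_dist': "branch_dist n' y' (s \<zeta>) (s 1) \<le> A8 * \<rho> powr (Q * real n')" if "\<zeta> \<in> R" for \<zeta>
  proof -
    have "\<epsilon> powr (q * real n * \<alpha>) = (\<epsilon> ^ n) powr (q * \<alpha>)"
      using \<epsilon> by (simp add: powr_powr mult_ac flip: powr_realpow)
    also have "\<dots> \<le> (A6 * \<rho> powr (real n' * \<alpha>)) powr (q * \<alpha>)"
      using \<epsilon>\<rho> \<epsilon> q \<alpha> by (intro powr_mono2) auto
    also have "\<dots> = A6 powr (q * \<alpha>) * \<rho> powr (Q * real n')"
      using A \<rho> by (simp add: powr_mult powr_powr Q_def power2_eq_square mult_ac)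
    finally have "A2 * \<epsilon> powr (q * real n * \<alpha>) \<le> A2 * (A6 powr (q * \<alpha>) * \<rho> powr (Q * real n'))"
      using A by (intro mult_left_mono) auto
    then show ?thesis using s_dist[OF that] by (simp add: A8_def mult_ac)
  qed

  \<comment> \<open>Images of points over one x need not lie over one x', so they are compared
    through the ratio of their x'-coordinates to that of s(1).\<close>
  define w where "w \<zeta> = (s \<zeta> / s 1) ^ n'" for \<zeta>
  have w_diff: "\<rho> ^ n' * norm (w \<zeta> - w \<xi>) = norm (s \<zeta> ^ n' - s \<xi> ^ n')" for \<zeta> \<xi>
    using \<open>s 1 \<noteq> 0\<close> by (simp add: w_def \<rho>_def power_divide flip: diff_divide_distrib norm_power norm_mult)
  have w1: "w 1 = 1" using \<open>s 1 \<noteq> 0\<close> by (simp add: w_def)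
  have w: "w \<zeta> \<in> ball 1 (1/2)" if "\<zeta> \<in> R" for \<zeta>
  proof -
    have "\<rho> ^ n' * norm (w \<zeta> - 1) \<le> branch_dist n' y' (s \<zeta>) (s 1)"
      using w_diff[of \<zeta> 1] w1 by (simp add: branch_dist_def)
    also have "\<dots> \<le> A8 * \<rho> powr (Q * real n')" by (rule s_dist'[OF that])
    also have "\<dots> = \<rho> ^ n' * (A8 * \<rho> powr ((Q - 1) * real n'))"
      using \<rho> by (simp add: algebra_simps flip: powr_realpow powr_add)
    also have "\<dots> < \<rho> ^ n' * (1/2)"
      using d5(2)[of \<rho>] \<rho> \<rho>0 by (intro mult_strict_left_mono) auto
    finally show ?thesis using \<rho> by (simp add: dist_norm norm_minus_commute)
  qed
  \<comment> \<open>\<omega>(\<zeta>) s(1) is the parameter on the sheet of s(\<zeta>) that lies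
    exactly over the x'-coordinate of s(1).\<close>
  define \<omega> where "\<omega> \<zeta> = s \<zeta> / (s 1 * root_near_1 n' (w \<zeta>))" for \<zeta>
  have s_eq: "s \<zeta> = (\<omega> \<zeta> * s 1) * root_near_1 n' (w \<zeta>)" for \<zeta>
    using \<open>s 1 \<noteq> 0\<close> by (simp add: \<omega>_def)
  have \<omega>R': "\<omega> \<zeta> ^ n' = 1" if "\<zeta> \<in> R" for \<zeta>
  proof -
    have "w \<zeta> \<noteq> 0" using ball_1_half(1)[OF w[OF that]] .
    moreover have "s \<zeta> ^ n' = w \<zeta> * s 1 ^ n'" using \<open>s 1 \<noteq> 0\<close> by (simp add: w_def power_divide)
    ultimately show ?thesis
      using \<open>s 1 \<noteq> 0\<close> y'(2) by (simp add: \<omega>_def power_divide power_mult_distrib root_near_1_power)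
  qed
  have norm\<omega>: "norm (\<omega> \<zeta> * s 1) = \<rho>" if "\<zeta> \<in> R" for \<zeta>
    using \<omega>R'[OF that] y'(2) power_eq_1_iff[of "\<omega> \<zeta>" n'] by (auto simp: norm_mult \<rho>_def)

  \<comment> \<open>Moving from s(\<zeta>) to \<omega>(\<zeta>) s(1) along the sheet changes y' by
    at most K times the change of x', and that change is itself part of the distance from s(\<zeta>)
    to s(1). The total is too small for a sheet of contact below Q.\<close>
  have "\<omega> \<zeta> \<in> R''" if \<zeta>: "\<zeta> \<in> R" for \<zeta>
  proof (rule ccontr)
    assume "\<omega> \<zeta> \<notin> R''"
    then obtain j where j: "fps_nth y' j \<noteq> 0" "real j < Q * real n'" "\<omega> \<zeta> ^ j \<noteq> 1"
      using power_contact_gcd_eq_1[OF \<omega>R'[OF \<zeta>] _ y'(2), of y' Q] by (auto simp: R''_def e'_def)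
    have "norm (eval_fps y' (\<omega> \<zeta> * s 1) - eval_fps y' (s 1))
        \<le> norm (eval_fps y' (\<omega> \<zeta> * s 1) - eval_fps y' (s \<zeta>)) + norm (eval_fps y' (s \<zeta>) - eval_fps y' (s 1))"
      by (rule norm_triangle_ineq[of "eval_fps y' (\<omega> \<zeta> * s 1) - eval_fps y' (s \<zeta>)"
            "eval_fps y' (s \<zeta>) - eval_fps y' (s 1)", simplified])
    also have "norm (eval_fps y' (\<omega> \<zeta> * s 1) - eval_fps y' (s \<zeta>)) \<le> K * \<rho> ^ n' * norm (1 - w \<zeta>)"
      using K(3)[of "\<omega> \<zeta> * s 1" 1 "w \<zeta>"] norm\<omega>[OF \<zeta>] \<rho> \<rho>0 w[OF \<zeta>] s_eq[of \<zeta>] by simp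
    also have "\<dots> = K * norm (s \<zeta> ^ n' - s 1 ^ n')"
      using w_diff[of \<zeta> 1] w1 by (simp add: norm_minus_commute)
    also have "K * norm (s \<zeta> ^ n' - s 1 ^ n') + norm (eval_fps y' (s \<zeta>) - eval_fps y' (s 1))
        \<le> (K + 1) * branch_dist n' y' (s \<zeta>) (s 1)"
      using K(1) by (simp add: branch_dist_def algebra_simps)
    also have "\<dots> \<le> (K + 1) * (A8 * \<rho> powr (Q * real n'))"
      using s_dist'[OF \<zeta>] K(1) by (intro mult_left_mono) auto
    also have "\<dots> < norm (eval_fps y' (\<omega> \<zeta> * s 1) - eval_fps y' (s 1))"
      using d4(2)[of "s 1" "\<omega> \<zeta>" j] j \<omega>R'[OF \<zeta>] \<rho> \<rho>0 by (simp add: R'_def \<rho>_def mult_ac)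
    finally show False by simp
  qed

  (* A path joining two image points on one sheet pulls back to a path on the first branch along
     which x stays within |x|/2 of its initial value, so the n-th root cannot change. *)
  moreover have "inj_on \<omega> R"
  proof (rule inj_onI)
    fix \<zeta> \<xi> assume \<zeta>: "\<zeta> \<in> R" and \<xi>: "\<xi> \<in> R" and eq: "\<omega> \<zeta> = \<omega> \<xi>"
    \<comment> \<open>The segment joins the two ratios inside the convex disc where the root is
      holomorphic; \<open>\<sigma>\<close> lifts it to the common sheet.\<close>
    define v where "v u = linepath (w \<zeta>) (w \<xi>) u" for u
    define \<sigma> where "\<sigma> u = (\<omega> \<zeta> * s 1) * root_near_1 n' (v u)" for u
    have v: "v u \<in> ball 1 (1/2)" if "u \<in> {0..1}" for u
    proof -
      have "v u \<in> closed_segment (w \<zeta>) (w \<xi>)"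
        using that linepath_image_01[of "w \<zeta>" "w \<xi>"] by (auto simp: v_def)
      then show ?thesis
        using closed_segment_subset[OF w[OF \<zeta>] w[OF \<xi>] convex_ball] by blast
    qed
    have v_dist: "norm (v u - w \<zeta>) \<le> norm (w \<zeta> - w \<xi>)" if "u \<in> {0..1}" for u
    proof -
      have "v u - w \<zeta> = u *\<^sub>R (w \<xi> - w \<zeta>)"
        by (simp add: v_def linepath_def algebra_simps)
      then show ?thesis using that
        by (simp add: norm_minus_commute mult_left_le_one_le)
    qed
    have \<sigma>_ball: "\<sigma> u \<in> ball 0 \<delta>" if "u \<in> {0..1}" for u
    proof -
      have "norm (\<sigma> u) = \<rho> * norm (root_near_1 n' (v u))"
        using norm\<omega>[OF \<zeta>] by (simp only: \<sigma>_def norm_mult)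
      also have "\<dots> < \<rho> * 2"
        using norm_root_near_1_less[OF y'(2) v[OF that]] \<rho> by (intro mult_strict_left_mono) auto
      finally show ?thesis using \<rho> \<rho>0 by simp
    qed
    have cont: "continuous_on {0..1} (\<lambda>u. k (\<sigma> u))"
    proof (rule continuous_on_compose2[OF contk])
      have "continuous_on {0..1} v" unfolding v_def by (intro continuous_intros)
      then have "continuous_on {0..1} (\<lambda>u. root_near_1 n' (v u))"
        using v by (intro continuous_on_compose2[OF continuous_on_root_near_1[OF y'(2)]]) auto
      then show "continuous_on {0..1} \<sigma>" unfolding \<sigma>_def by (intro continuous_intros)
    qed (use \<sigma>_ball in auto)
    have \<sigma>0: "\<sigma> 0 = s \<zeta>" using s_eq[of \<zeta>] by (simp add: \<sigma>_def v_def linepath_def)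
    have \<sigma>1: "\<sigma> 1 = s \<xi>" using s_eq[of \<xi>] eq by (simp add: \<sigma>_def v_def linepath_def)
    \<comment> \<open>\<open>2 * A2\<close> because each end point is only known to be close to
      s(1).\<close>
    have \<sigma>_dist: "branch_dist n' y' (\<sigma> u) (s \<zeta>) \<le> ((K + 1) * (2 * A2)) * \<epsilon> powr (q * real n * \<alpha>)"
      if u: "u \<in> {0..1}" for u
    proof -
      have "\<sigma> u ^ n' = (\<omega> \<zeta> * s 1) ^ n' * v u" "s \<zeta> ^ n' = (\<omega> \<zeta> * s 1) ^ n' * w \<zeta>"
        using root_near_1_power[OF y'(2)] ball_1_half(1)[OF v[OF u]] ball_1_half(1)[OF w[OF \<zeta>]]
        by (simp_all add: \<sigma>_def power_mult_distrib s_eq[of \<zeta>])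
      then have "norm (\<sigma> u ^ n' - s \<zeta> ^ n') = \<rho> ^ n' * norm (v u - w \<zeta>)"
        using norm\<omega>[OF \<zeta>] by (simp only: norm_mult norm_power flip: right_diff_distrib)
      moreover have "norm (eval_fps y' (\<sigma> u) - eval_fps y' (s \<zeta>)) \<le> K * \<rho> ^ n' * norm (v u - w \<zeta>)"
        using K(3)[of "\<omega> \<zeta> * s 1" "v u" "w \<zeta>"] norm\<omega>[OF \<zeta>] \<rho> \<rho>0 w[OF \<zeta>] v[OF u] s_eq[of \<zeta>]
        by (simp add: \<sigma>_def)
      ultimately have "branch_dist n' y' (\<sigma> u) (s \<zeta>) \<le> (K + 1) * (\<rho> ^ n' * norm (v u - w \<zeta>))"
        by (simp add: branch_dist_def algebra_simps)
      also have "\<rho> ^ n' * norm (v u - w \<zeta>) \<le> \<rho> ^ n' * norm (w \<zeta> - w \<xi>)"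
        using v_dist[OF u] \<rho> by (intro mult_left_mono) auto
      also have "\<dots> = norm (s \<zeta> ^ n' - s \<xi> ^ n')" by (rule w_diff)
      also have "\<dots> \<le> branch_dist n' y' (s \<zeta>) (s \<xi>)" by (simp add: branch_dist_def)
      also have "\<dots> \<le> branch_dist n' y' (s \<zeta>) (s 1) + branch_dist n' y' (s \<xi>) (s 1)"
        using branch_dist_triangle[of n' y' "s \<zeta>" "s \<xi>" "s 1"] by (simp add: branch_dist_commute)
      also have "\<dots> \<le> 2 * A2 * \<epsilon> powr (q * real n * \<alpha>)"
        using s_dist[OF \<zeta>] s_dist[OF \<xi>] by simp
      finally show ?thesis using K(1) by (simp add: mult.assoc)
    qed
    have "k (\<sigma> 0) = k (\<sigma> 1)"
    proof (rule nth_root_path_closed[OF y(2) cont])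
      show "k (\<sigma> 0) ^ n = of_real \<epsilon> ^ n" "k (\<sigma> 1) ^ n = of_real \<epsilon> ^ n"
        using ks p(3) \<zeta> \<xi> \<sigma>0 \<sigma>1 by simp_all
      show "of_real \<epsilon> ^ n \<noteq> (0::complex)" using \<epsilon> by simp
      fix u :: real assume u: "u \<in> {0..1}"
      have "norm (k (\<sigma> u) ^ n - of_real \<epsilon> ^ n) \<le> branch_dist n y (k (\<sigma> u)) (k (s \<zeta>))"
        using ks[OF \<zeta>] p(3)[OF \<zeta>] by (simp add: branch_dist_def)
      also have "\<dots> \<le> c * branch_dist n' y' (\<sigma> u) (s \<zeta>) powr \<alpha>"
        by (intro k \<sigma>_ball s_ball \<zeta> u)
      also have "\<dots> \<le> c * (((K + 1) * (2 * A2)) * \<epsilon> powr (q * real n * \<alpha>)) powr \<alpha>"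
        using \<sigma>_dist[OF u] c \<alpha> by (intro mult_left_mono powr_mono2) (auto simp: branch_dist_nonneg)
      also have "\<dots> = A9 * (\<epsilon> powr (q * real n * \<alpha>)) powr \<alpha>"
        using K A \<epsilon> by (simp only: powr_mult A9_def mult.assoc)
      \<comment> \<open>As Q = \<alpha>^2 q, applying the exponent \<alpha> twice leaves
        \<epsilon>^n times a positive power of \<epsilon>.\<close>
      also have "(\<epsilon> powr (q * real n * \<alpha>)) powr \<alpha> = \<epsilon> powr (real n + (Q - 1) * real n)"
        by (simp add: powr_powr Q_def power2_eq_square algebra_simps)
      also have "\<dots> = \<epsilon> ^ n * \<epsilon> powr ((Q - 1) * real n)"
        using \<epsilon> by (simp add: powr_realpow powr_add)
      also have "A9 * (\<epsilon> ^ n * \<epsilon> powr ((Q - 1) * real n)) = \<epsilon> ^ n * (A9 * \<epsilon> powr ((Q - 1) * real n))"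
        by simp
      also have "\<dots> < \<epsilon> ^ n * (1/2)"
        using d7(2)[of \<epsilon>] \<epsilon> by (intro mult_strict_left_mono) auto
      finally show "norm (k (\<sigma> u) ^ n - of_real \<epsilon> ^ n) < norm (of_real \<epsilon> ^ n :: complex) / 2"
        using \<epsilon> by (simp add: norm_power)
    qed
    then have "p \<zeta> = p \<xi>" using ks \<zeta> \<xi> \<sigma>0 \<sigma>1 by simp
    then show "\<zeta> = \<xi>" using \<epsilon> by (simp add: p_def)
  qed

  ultimately have "card R \<le> card R''"
    using fin by (intro card_inj_on_le[of \<omega>]) auto
  then show ?thesis using card by (simp add: e_def e'_def Q_def)
qed

section \<open>Holomorphic functions of two variables\<close>

lemma holomorphic2_on_subset: "f holomorphic2_on U \<Longrightarrow> V \<subseteq> U \<Longrightarrow> f holomorphic2_on V"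
  by (auto simp: holomorphic2_on_def)

lemma holomorphic2_imp_continuous_on: "f holomorphic2_on U \<Longrightarrow> continuous_on U f"
  unfolding holomorphic2_on_def
  by (blast intro: continuous_at_imp_continuous_on has_derivative_continuous)

lemma holomorphic2_along_curve:
  assumes "f holomorphic2_on U" "(g t, h t) \<in> U" "g field_differentiable at t" "h field_differentiable at t"
  shows "(\<lambda>t. f (g t, h t)) field_differentiable at t"
proof -
  obtain a b where f: "(f has_derivative (\<lambda>h. a * fst h + b * snd h)) (at (g t, h t))"
    using assms by (auto simp: holomorphic2_on_def)
  obtain g' h' where g': "(g has_derivative (\<lambda>x. g' * x)) (at t)" and h': "(h has_derivative (\<lambda>x. h' * x)) (at t)"
    using assms(3,4) by (auto simp: field_differentiable_def has_field_derivative_def)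
  have "((\<lambda>t. (g t, h t)) has_derivative (\<lambda>x. (g' * x, h' * x))) (at t)"
    by (rule has_derivative_Pair[OF g' h'])
  from has_derivative_compose[OF this f]
  have "((\<lambda>t. f (g t, h t)) has_derivative (\<lambda>x. (a * g' + b * h') * x)) (at t)"
    by (simp add: algebra_simps)
  then show ?thesis by (auto simp: field_differentiable_def has_field_derivative_def)
qed

lemma holomorphic2_compose:
  assumes "f holomorphic2_on V" "(fst \<circ> \<phi>) holomorphic2_on U" "(snd \<circ> \<phi>) holomorphic2_on U" "\<phi> ` U \<subseteq> V"
  shows "(f \<circ> \<phi>) holomorphic2_on U"
  unfolding holomorphic2_on_def
proof
  fix z assume z: "z \<in> U"
  obtain a b where f: "(f has_derivative (\<lambda>h. a * fst h + b * snd h)) (at (\<phi> z))"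
    using assms z by (fastforce simp: holomorphic2_on_def)
  obtain c d where g': "((\<lambda>z. fst (\<phi> z)) has_derivative (\<lambda>h. c * fst h + d * snd h)) (at z)"
    using assms(2) z by (auto simp: holomorphic2_on_def o_def)
  obtain c' d' where h': "((\<lambda>z. snd (\<phi> z)) has_derivative (\<lambda>h. c' * fst h + d' * snd h)) (at z)"
    using assms(3) z by (auto simp: holomorphic2_on_def o_def)
  have "(\<phi> has_derivative (\<lambda>h. (c * fst h + d * snd h, c' * fst h + d' * snd h))) (at z)"
    using has_derivative_Pair[OF g' h'] by simp
  from has_derivative_compose[OF this f]
  have "((f \<circ> \<phi>) has_derivative (\<lambda>h. (a * c + b * c') * fst h + (a * d + b * d') * snd h)) (at z)"
    by (simp add: algebra_simps o_def)
  then show "\<exists>a b. ((f \<circ> \<phi>) has_derivative (\<lambda>h. a * fst h + b * snd h)) (at z)" by blast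
qed

lemma cball_Times_subset_open:
  fixes a :: "'a::metric_space" and b :: "'b::metric_space"
  assumes "open U" "(a, b) \<in> U"
  obtains \<rho> where "\<rho> > 0" "cball a \<rho> \<times> cball b \<rho> \<subseteq> U"
proof -
  obtain A B where AB: "open A" "open B" "a \<in> A" "b \<in> B" "A \<times> B \<subseteq> U"
    using open_prod_elim[OF assms] by (metis mem_Times_iff fst_conv snd_conv)
  obtain r s where "r > 0" "cball a r \<subseteq> A" "s > 0" "cball b s \<subseteq> B"
    using AB open_contains_cball by metis
  then show thesis using AB(5)
    by (intro that[of "min r s"]) (auto simp: subset_eq)
qed

text \<open>The integrand is jointly continuous in the parameters and in the time on the circle,
  whose points stay off the open disc. It is applied with j = 2 to the formula for a derivative and
  with j = 1 to the formula defining a quotient.\<close>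

lemma continuous_on_circlepath_kernel:
  fixes H :: "'a::topological_space \<times> complex \<Rightarrow> complex"
  assumes H: "continuous_on (S \<times> sphere z \<rho>) H" and \<rho>: "\<rho> > 0"
  shows "continuous_on (S \<times> ball z \<rho>)
           (\<lambda>p. contour_integral (circlepath z \<rho>) (\<lambda>u. H (fst p, u) / (u - snd p) ^ j))"
proof -
  define w where "w = circlepath z \<rho>"
  define w' where "w' t = 2 * pi * \<i> * \<rho> * exp (2 * of_real pi * \<i> * of_real t)" for t :: real
  have w_sphere: "w t \<in> sphere z \<rho>" for t
    using \<rho> by (simp add: w_def circlepath dist_norm norm_mult norm_exp_eq_Re)
  have w_neq: "w t \<noteq> y" if "y \<in> ball z \<rho>" for t y
    using w_sphere[of t] that by auto
  have contw: "continuous_on T w" for T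
    unfolding w_def circlepath by (intro continuous_intros)
  have "continuous_on ((S \<times> ball z \<rho>) \<times> cbox 0 1)
      (\<lambda>(p, t). H (fst p, w t) / (w t - snd p) ^ j * w' t)"
    unfolding case_prod_unfold
  proof (intro continuous_intros)
    show "continuous_on ((S \<times> ball z \<rho>) \<times> cbox 0 1) (\<lambda>p. H (fst (fst p), w (snd p)))"
      using w_sphere
      by (intro continuous_on_compose2[OF H] continuous_intros continuous_on_compose2[OF contw[of UNIV]]) auto
  qed (use w_neq in \<open>auto simp: w'_def intro!: continuous_intros continuous_on_compose2[OF contw[of UNIV]]\<close>)
  from integral_continuous_on_param[OF this] show ?thesis
    by (simp add: contour_integral_integral vector_derivative_circlepath w_def w'_def case_prod_unfold)
qed

text \<open>Osgood's lemma.\<close>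

lemma holomorphic2_onI:
  assumes U: "open U" and cont: "continuous_on U f"
    and dx: "\<And>x y. (x, y) \<in> U \<Longrightarrow> (\<lambda>x. f (x, y)) field_differentiable at x"
    and dy: "\<And>x y. (x, y) \<in> U \<Longrightarrow> (\<lambda>y. f (x, y)) field_differentiable at y"
  shows "f holomorphic2_on U"
  unfolding holomorphic2_on_def
proof
  fix z assume "z \<in> U"
  obtain x0 y0 where z: "z = (x0, y0)" by (cases z)
  obtain \<rho> where \<rho>: "\<rho> > 0" "cball x0 \<rho> \<times> cball y0 \<rho> \<subseteq> U"
    using cball_Times_subset_open[OF U] \<open>z \<in> U\<close> z by blast
  define X where "X = ball x0 \<rho>"
  define Y where "Y = ball y0 \<rho>"
  \<comment> \<open>Cauchy's formula expresses the partial derivative in y through values of f on a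
    circle, so continuity of f already makes it jointly continuous.\<close>
  define D where "D p = 1 / (2 * of_real pi * \<i>) *
      contour_integral (circlepath y0 \<rho>) (\<lambda>u. f (fst p, u) / (u - snd p)^2)" for p
  have D: "((\<lambda>y. f (x, y)) has_field_derivative D (x, y)) (at y)" if "x \<in> X" "y \<in> Y" for x y
  proof -
    have hol: "(\<lambda>y. f (x, y)) holomorphic_on cball y0 \<rho>"
      unfolding holomorphic_on_def
      using that \<rho>(2) by (intro ballI field_differentiable_at_within[OF dy]) (auto simp: X_def subset_eq)
    show ?thesis unfolding D_def fst_conv snd_conv
      by (rule Cauchy_derivative_integral_circlepath(2))
        (use hol that in \<open>auto simp: Y_def intro: holomorphic_on_imp_continuous_on holomorphic_on_subset\<close>)
  qed
  have contD: "continuous_on (X \<times> Y) D"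
    unfolding D_def Y_def using \<rho>
    by (intro continuous_intros continuous_on_circlepath_kernel continuous_on_subset[OF cont]) (auto simp: X_def)
  have opn: "open (X \<times> Y)" "(x0, y0) \<in> X \<times> Y"
    using \<rho>(1) by (auto simp: X_def Y_def open_Times)
  obtain a where "((\<lambda>x. f (x, y0)) has_field_derivative a) (at x0)"
    using dx[of x0 y0] \<open>z \<in> U\<close> z by (auto simp: field_differentiable_def)
  then have a: "((\<lambda>x. f (x, y0)) has_derivative (*) a) (at x0 within X)"
    by (simp add: has_field_derivative_def has_derivative_at_withinI)
  \<comment> \<open>One partial derivative at the point together with the other one existing nearby
    and continuous there gives the total derivative.\<close>
  have "((\<lambda>(x, y). f (x, y)) has_derivative
      (\<lambda>(tx, ty). a * tx + blinfun_apply (blinfun_mult_right (D (x0, y0))) ty))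
      (at (x0, y0) within X \<times> Y)"
  proof (rule has_derivative_partialsI)
    show "((\<lambda>x. f (x, y0)) has_derivative (*) a) (at x0 within X)" by (rule a)
    show "((\<lambda>y. f (x, y)) has_derivative blinfun_apply (blinfun_mult_right (D (x, y)))) (at y within Y)"
      if "x \<in> X" "y \<in> Y" for x y
      using has_derivative_at_withinI[OF D[OF that, unfolded has_field_derivative_def]]
      by (simp add: blinfun_mult_right.rep_eq)
    have "continuous (at (x0, y0) within X \<times> Y) (\<lambda>p. blinfun_mult_right (D p))"
      by (intro bounded_linear.continuous[OF bounded_linear_blinfun_mult_right])
         (use contD opn in \<open>auto simp: continuous_on_eq_continuous_within\<close>)
    then show "continuous (at (x0, y0) within X \<times> Y) (\<lambda>(x, y). blinfun_mult_right (D (x, y)))"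
      by (simp add: case_prod_unfold)
    show "y0 \<in> Y" "convex Y" using \<rho>(1) by (auto simp: Y_def)
  qed
  then have "(f has_derivative (\<lambda>h. a * fst h + D (x0, y0) * snd h)) (at z)"
    using at_within_open[OF opn(2,1)] by (simp add: z case_prod_unfold blinfun_mult_right.rep_eq)
  then show "\<exists>a b. (f has_derivative (\<lambda>h. a * fst h + b * snd h)) (at z)" by blast
qed

section \<open>Local Lipschitz bounds for holomorphic maps\<close>

lemma holomorphic_bounded_imp_lipschitz:
  fixes g :: "complex \<Rightarrow> complex"
  assumes "g holomorphic_on cball a (2 * \<rho>)" "\<rho> > 0" "\<And>x. x \<in> cball a (2 * \<rho>) \<Longrightarrow> norm (g x) \<le> B"
    and "x \<in> ball a \<rho>" "x' \<in> ball a \<rho>"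
  shows "norm (g x - g x') \<le> B / \<rho> * norm (x - x')"
proof (rule field_differentiable_bound[of "ball a \<rho>" g "deriv g"])
  have sub: "cball z \<rho> \<subseteq> cball a (2 * \<rho>)" if "z \<in> ball a \<rho>" for z
  proof
    fix u assume "u \<in> cball z \<rho>"
    then show "u \<in> cball a (2 * \<rho>)" using that dist_triangle[of a u z] by simp
  qed
  fix z assume z: "z \<in> ball a \<rho>"
  have hol: "g holomorphic_on ball z \<rho>" "g holomorphic_on cball z \<rho>"
    using holomorphic_on_subset[OF assms(1)] sub[OF z] ball_subset_cball[of z \<rho>] by blast+
  then have "g field_differentiable at z"
    using \<open>\<rho> > 0\<close> holomorphic_on_imp_differentiable_at[OF hol(1)] by simp
  then show "(g has_field_derivative deriv g z) (at z within ball a \<rho>)"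
    by (simp add: DERIV_deriv_iff_field_differentiable has_field_derivative_at_within)
  have "norm ((deriv ^^ 1) g z) \<le> fact 1 * B / \<rho> ^ 1"
  proof (rule Cauchy_inequality[OF hol(1) holomorphic_on_imp_continuous_on[OF hol(2)] \<open>\<rho> > 0\<close>])
    show "norm (g x) \<le> B" if "norm (z - x) = \<rho>" for x
      using that sub[OF z] by (intro assms(3)) (auto simp: dist_norm)
  qed
  then show "norm (deriv g z) \<le> B / \<rho>" by simp
qed (use assms in auto)

text \<open>Changing one coordinate at a time reduces this to one variable, where Cauchy's estimate
  on discs of radius \<rho> bounds the derivative by B / \<rho>. These discs reach out to twice the
  radius, hence \<rho> = r / 2.\<close>

lemma holomorphic2_imp_locally_lipschitz:
  assumes f: "f holomorphic2_on U" and U: "open U" "z \<in> U"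
  obtains d L where "d > 0" "L > 0" "ball z d \<subseteq> U"
    "\<And>p q. p \<in> ball z d \<Longrightarrow> q \<in> ball z d \<Longrightarrow> norm (f p - f q) \<le> L * norm (p - q)"
proof -
  obtain x0 y0 where z: "z = (x0, y0)" by (cases z)
  obtain r where r: "r > 0" "cball x0 r \<times> cball y0 r \<subseteq> U"
    using cball_Times_subset_open[OF U(1)] U(2) z by blast
  define \<rho> where "\<rho> = r / 2"
  have "compact (f ` (cball x0 r \<times> cball y0 r))"
    by (intro compact_continuous_image compact_Times compact_cball
        continuous_on_subset[OF holomorphic2_imp_continuous_on[OF f] r(2)])
  then obtain B where B: "B > 0" "\<And>p. p \<in> cball x0 r \<times> cball y0 r \<Longrightarrow> norm (f p) \<le> B"
    using compact_imp_bounded bounded_pos by (metis image_eqI)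
  have \<rho>: "\<rho> > 0" using r(1) by (simp add: \<rho>_def)
  have sub: "ball y0 \<rho> \<subseteq> cball y0 r" "ball x0 \<rho> \<subseteq> cball x0 r" using r(1) by (auto simp: \<rho>_def)
  have 1: "norm (f (x, y) - f (x', y)) \<le> B / \<rho> * norm (x - x')"
    if "x \<in> ball x0 \<rho>" "x' \<in> ball x0 \<rho>" "y \<in> ball y0 \<rho>" for x x' y
  proof (rule holomorphic_bounded_imp_lipschitz[where a = x0])
    show "(\<lambda>x. f (x, y)) holomorphic_on cball x0 (2 * \<rho>)"
      unfolding holomorphic_on_def
      using that(3) r(2) sub
      by (intro ballI field_differentiable_at_within[OF holomorphic2_along_curve[OF f]])
        (auto simp: \<rho>_def subset_eq)
  qed (use that B sub \<rho> in \<open>auto simp: \<rho>_def\<close>)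
  have 2: "norm (f (x, y) - f (x, y')) \<le> B / \<rho> * norm (y - y')"
    if "y \<in> ball y0 \<rho>" "y' \<in> ball y0 \<rho>" "x \<in> ball x0 \<rho>" for x y y'
  proof (rule holomorphic_bounded_imp_lipschitz[where a = y0])
    show "(\<lambda>y. f (x, y)) holomorphic_on cball y0 (2 * \<rho>)"
      unfolding holomorphic_on_def
      using that(3) r(2) sub
      by (intro ballI field_differentiable_at_within[OF holomorphic2_along_curve[OF f]])
        (auto simp: \<rho>_def subset_eq)
  qed (use that B sub \<rho> in \<open>auto simp: \<rho>_def\<close>)
  have inball: "fst p \<in> ball x0 \<rho>" "snd p \<in> ball y0 \<rho>" if "p \<in> ball z \<rho>" for p
    using that dist_fst_le[of z p] dist_snd_le[of z p] by (auto simp: z)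
  show thesis
  proof (rule that[of \<rho> "2 * B / \<rho>"])
    show "ball z \<rho> \<subseteq> U" 
    proof
      fix p assume "p \<in> ball z \<rho>"
      then have "fst p \<in> cball x0 r" "snd p \<in> cball y0 r" using inball[of p] sub by blast+
      then have "p \<in> cball x0 r \<times> cball y0 r" by (simp add: mem_Times_iff)
      then show "p \<in> U" using r(2) by blast
    qed
    fix p q assume pq: "p \<in> ball z \<rho>" "q \<in> ball z \<rho>"
    have "norm (f p - f q) \<le> norm (f (fst p, snd p) - f (fst q, snd p)) + norm (f (fst q, snd p) - f (fst q, snd q))"
      using norm_triangle_ineq[of "f (fst p, snd p) - f (fst q, snd p)" "f (fst q, snd p) - f (fst q, snd q)"]
      by simp
    also have "\<dots> \<le> B / \<rho> * norm (fst p - fst q) + B / \<rho> * norm (snd p - snd q)"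
      by (intro add_mono 1 2 inball pq)
    also have "\<dots> \<le> B / \<rho> * norm (p - q) + B / \<rho> * norm (p - q)"
      using B(1) \<rho> dist_fst_le[of p q] dist_snd_le[of p q]
      by (intro add_mono mult_left_mono) (auto simp: dist_norm)
    finally show "norm (f p - f q) \<le> 2 * B / \<rho> * norm (p - q)" by simp
  qed (use B \<rho> in auto)
qed

section \<open>Parametrizations as charts\<close>

lemma holomorphic2_pair_imp_locally_lipschitz:
  assumes "(fst \<circ> \<phi>) holomorphic2_on U" "(snd \<circ> \<phi>) holomorphic2_on U" "open U" "z \<in> U"
  obtains d L where "d > 0" "L > 0" "ball z d \<subseteq> U"
    "\<And>p q. p \<in> ball z d \<Longrightarrow> q \<in> ball z d \<Longrightarrow> norm (\<phi> p - \<phi> q) \<le> L * norm (p - q)"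
proof -
  obtain d1 L1 where 1: "d1 > 0" "L1 > 0" "ball z d1 \<subseteq> U"
    "\<And>p q. p \<in> ball z d1 \<Longrightarrow> q \<in> ball z d1 \<Longrightarrow> norm ((fst \<circ> \<phi>) p - (fst \<circ> \<phi>) q) \<le> L1 * norm (p - q)"
    using holomorphic2_imp_locally_lipschitz[OF assms(1,3,4)] by blast
  obtain d2 L2 where 2: "d2 > 0" "L2 > 0" "ball z d2 \<subseteq> U"
    "\<And>p q. p \<in> ball z d2 \<Longrightarrow> q \<in> ball z d2 \<Longrightarrow> norm ((snd \<circ> \<phi>) p - (snd \<circ> \<phi>) q) \<le> L2 * norm (p - q)"
    using holomorphic2_imp_locally_lipschitz[OF assms(2,3,4)] by blast
  show thesis
  proof (rule that[of "min d1 d2" "L1 + L2"])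
    fix p q assume pq: "p \<in> ball z (min d1 d2)" "q \<in> ball z (min d1 d2)"
    have "norm (\<phi> p - \<phi> q) \<le> norm (fst (\<phi> p) - fst (\<phi> q)) + norm (snd (\<phi> p) - snd (\<phi> q))"
      using norm_Pair_le[of "fst (\<phi> p) - fst (\<phi> q)" "snd (\<phi> p) - snd (\<phi> q)"] by (simp add: minus_prod_def)
    also have "\<dots> \<le> (L1 + L2) * norm (p - q)"
      using 1(4)[of p q] 2(4)[of p q] pq by (simp add: distrib_right)
    finally show "norm (\<phi> p - \<phi> q) \<le> (L1 + L2) * norm (p - q)" .
  qed (use 1 2 in auto)
qed

text \<open>What the Hoelder estimates retain of a parametrization: \<open>\<gamma>\<close> turns
  the Euclidean distance on C into \<open>branch_dist\<close> up to the factor L, and its image is a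
  neighbourhood of 0 in C. The analytic coordinates no longer occur.\<close>

definition branch_chart ::
    "(complex \<times> complex) set \<Rightarrow> nat \<Rightarrow> complex fps \<Rightarrow> (complex \<Rightarrow> complex \<times> complex) \<Rightarrow> real \<Rightarrow> real \<Rightarrow> bool" where
  "branch_chart C n y \<gamma> r L \<longleftrightarrow>
     0 < r \<and> 0 < L \<and> \<gamma> 0 = 0 \<and> continuous_on (ball 0 r) \<gamma> \<and> inj_on \<gamma> (ball 0 r) \<and>
     \<gamma> ` ball 0 r \<subseteq> C \<and> (\<exists>W. open W \<and> 0 \<in> W \<and> C \<inter> W \<subseteq> \<gamma> ` ball 0 r) \<and>
     (\<forall>t\<in>ball 0 r. \<forall>s\<in>ball 0 r.
        norm (\<gamma> t - \<gamma> s) \<le> L * branch_dist n y t s \<and> branch_dist n y t s \<le> L * norm (\<gamma> t - \<gamma> s))"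

lemma parametrized_byE:
  assumes "parametrized_by C n y" "n > 0" "0 \<in> C"
  obtains \<phi> \<psi> U V r where "open U" "0 \<in> U" "open V" "0 \<in> V" "\<phi> 0 = 0" "\<psi> 0 = 0"
    "\<And>z. z \<in> U \<Longrightarrow> \<psi> (\<phi> z) = z" "\<And>z. z \<in> V \<Longrightarrow> \<phi> (\<psi> z) = z" "\<phi> ` U = V" "\<psi> ` V = U"
    "continuous_on U \<phi>" "continuous_on V \<psi>"
    "(fst \<circ> \<phi>) holomorphic2_on U" "(snd \<circ> \<phi>) holomorphic2_on U"
    "(fst \<circ> \<psi>) holomorphic2_on V" "(snd \<circ> \<psi>) holomorphic2_on V"
    "0 < r" "ereal r \<le> fps_conv_radius y" "eval_fps y 0 = 0"
    "inj_on (\<lambda>t. (t ^ n, eval_fps y t)) (ball 0 r)"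
    "continuous_on (ball 0 r) (\<lambda>t. (t ^ n, eval_fps y t))"
    "\<phi> ` (C \<inter> U) = (\<lambda>t. (t ^ n, eval_fps y t)) ` ball 0 r"
    "\<And>t. t \<in> ball 0 r \<Longrightarrow> (t ^ n, eval_fps y t) \<in> V \<and> \<psi> (t ^ n, eval_fps y t) \<in> C \<inter> U"
proof -
  obtain \<phi> U r where \<phi>: "analytic_coordinate_change \<phi> U" and r: "0 < r" "ereal r \<le> fps_conv_radius y"
    and inj: "inj_on (\<lambda>t. (t ^ n, eval_fps y t)) (ball 0 r)"
    and img: "\<phi> ` (C \<inter> U) = (\<lambda>t. (t ^ n, eval_fps y t)) ` ball 0 r"
    using assms(1) unfolding parametrized_by_def by blast
  obtain V \<psi> where U: "open U" "0 \<in> U" and V: "open V" and hom: "homeomorphism U V \<phi> \<psi>" and \<phi>0: "\<phi> 0 = 0"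
    and hol: "(fst \<circ> \<phi>) holomorphic2_on U" "(snd \<circ> \<phi>) holomorphic2_on U"
      "(fst \<circ> \<psi>) holomorphic2_on V" "(snd \<circ> \<psi>) holomorphic2_on V"
    using \<phi> unfolding analytic_coordinate_change_def by blast
  have inv: "\<And>z. z \<in> U \<Longrightarrow> \<psi> (\<phi> z) = z" "\<And>z. z \<in> V \<Longrightarrow> \<phi> (\<psi> z) = z" "\<phi> ` U = V" "\<psi> ` V = U"
    and cont: "continuous_on U \<phi>" "continuous_on V \<psi>"
    using hom by (auto simp: homeomorphism_def)
  have V0: "0 \<in> V" "\<psi> 0 = 0" using inv U(2) \<phi>0 by (metis imageI)+
  \<comment> \<open>The origin has to be one of the points (t^n, y(t)), which forces t = 0 and thus
    y(0) = 0.\<close>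
  have "0 \<in> \<phi> ` (C \<inter> U)" using assms(3) U(2) \<phi>0 by (metis IntI image_eqI)
  then obtain t where "(t ^ n, eval_fps y t) = 0" using img by auto
  then have y0: "eval_fps y 0 = 0" using assms(2) by (auto simp: zero_prod_def)
  have contG: "continuous_on (ball 0 r) (\<lambda>t. (t ^ n, eval_fps y t))"
  proof -
    have "ereal (norm t) < fps_conv_radius y" if "t \<in> ball 0 r" for t :: complex
      using less_le_trans[OF _ r(2), of "ereal (norm t)"] that by simp
    then have "ball 0 r \<subseteq> eball (0::complex) (fps_conv_radius y)" by auto
    then show ?thesis by (intro continuous_intros) (simp only: image_ident)
  qed
  have GV: "(t ^ n, eval_fps y t) \<in> V \<and> \<psi> (t ^ n, eval_fps y t) \<in> C \<inter> U" if "t \<in> ball 0 r" for t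
  proof -
    have "(t ^ n, eval_fps y t) \<in> \<phi> ` (C \<inter> U)" unfolding img using that by (rule imageI)
    then obtain z where z: "z \<in> C \<inter> U" "(t ^ n, eval_fps y t) = \<phi> z" by blast
    have "\<psi> (t ^ n, eval_fps y t) = z" using z inv(1)[of z] by simp
    moreover have "(t ^ n, eval_fps y t) \<in> V" unfolding z(2) using z(1) inv(3) by blast
    ultimately show ?thesis using z by simp
  qed
  show thesis
    by (rule that[OF U V V0(1) \<phi>0 V0(2) inv cont hol r y0 inj contG img GV])
qed

text \<open>The coordinate change and its inverse are both holomorphic, hence locally Lipschitz. The
  disc is shrunk until the model points G(t) and the points \<gamma>(t) lie where the two bounds
  hold.\<close>

lemma parametrized_by_imp_branch_chart:
  assumes "parametrized_by C n y" "n > 0" "0 \<in> C"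
  obtains \<gamma> r L where "branch_chart C n y \<gamma> r L"
proof -
  obtain \<phi> \<psi> U V r where U: "open U" "0 \<in> U" and V: "open V" "0 \<in> V" and \<phi>0: "\<phi> 0 = 0" "\<psi> 0 = 0"
    and inv: "\<And>z. z \<in> U \<Longrightarrow> \<psi> (\<phi> z) = z" "\<And>z. z \<in> V \<Longrightarrow> \<phi> (\<psi> z) = z" "\<phi> ` U = V" "\<psi> ` V = U"
    and cont: "continuous_on U \<phi>" "continuous_on V \<psi>"
    and hol: "(fst \<circ> \<phi>) holomorphic2_on U" "(snd \<circ> \<phi>) holomorphic2_on U"
      "(fst \<circ> \<psi>) holomorphic2_on V" "(snd \<circ> \<psi>) holomorphic2_on V"
    and r: "0 < r" "ereal r \<le> fps_conv_radius y" and y0: "eval_fps y 0 = 0"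
    and inj: "inj_on (\<lambda>t. (t ^ n, eval_fps y t)) (ball 0 r)"
    and contG0: "continuous_on (ball 0 r) (\<lambda>t. (t ^ n, eval_fps y t))"
    and img: "\<phi> ` (C \<inter> U) = (\<lambda>t. (t ^ n, eval_fps y t)) ` ball 0 r"
    and GV0: "\<And>t. t \<in> ball 0 r \<Longrightarrow> (t ^ n, eval_fps y t) \<in> V \<and> \<psi> (t ^ n, eval_fps y t) \<in> C \<inter> U"
    by (rule parametrized_byE[OF assms]) (rule that; assumption)
  define G where "G t = (t ^ n, eval_fps y t)" for t
  have G0: "G 0 = 0" using y0 assms(2) by (simp add: G_def zero_prod_def)
  have contG: "continuous_on (ball 0 r) G" using contG0 by (simp add: G_def)
  have GV: "G t \<in> V \<and> \<psi> (G t) \<in> C \<inter> U" if "t \<in> ball 0 r" for t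
    using GV0[OF that] by (simp add: G_def)
  have G_upper: "norm (G t - G s) \<le> branch_dist n y t s" for t s
    using norm_Pair_le[of "t ^ n - s ^ n" "eval_fps y t - eval_fps y s"]
    by (simp add: G_def branch_dist_def)
  have G_lower: "branch_dist n y t s \<le> 2 * norm (G t - G s)" for t s
    using norm_fst_le[of "t ^ n - s ^ n" "eval_fps y t - eval_fps y s"]
      norm_snd_le[of "eval_fps y t - eval_fps y s" "t ^ n - s ^ n"]
    by (simp add: G_def branch_dist_def)
  obtain a L1 where L1: "a > 0" "L1 > 0" "ball 0 a \<subseteq> U"
    "\<And>p q. p \<in> ball 0 a \<Longrightarrow> q \<in> ball 0 a \<Longrightarrow> norm (\<phi> p - \<phi> q) \<le> L1 * norm (p - q)"
    using holomorphic2_pair_imp_locally_lipschitz[OF hol(1,2) U] by blast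
  obtain b L2 where L2: "b > 0" "L2 > 0" "ball 0 b \<subseteq> V"
    "\<And>p q. p \<in> ball 0 b \<Longrightarrow> q \<in> ball 0 b \<Longrightarrow> norm (\<psi> p - \<psi> q) \<le> L2 * norm (p - q)"
    using holomorphic2_pair_imp_locally_lipschitz[OF hol(3,4) V] by blast
  have cont\<gamma>: "continuous_on (ball 0 r) (\<lambda>t. \<psi> (G t))"
    using GV by (intro continuous_on_compose2[OF cont(2) contG]) auto
  have "open (ball 0 r \<inter> G -` ball 0 b)"
    by (rule continuous_open_preimage[OF contG]) auto
  moreover have "open (ball 0 r \<inter> (\<lambda>t. \<psi> (G t)) -` ball 0 a)"
    by (rule continuous_open_preimage[OF cont\<gamma>]) auto
  ultimately have "open ((ball 0 r \<inter> G -` ball 0 b) \<inter> (ball 0 r \<inter> (\<lambda>t. \<psi> (G t)) -` ball 0 a))"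
    by (rule open_Int)
  moreover have "0 \<in> (ball 0 r \<inter> G -` ball 0 b) \<inter> (ball 0 r \<inter> (\<lambda>t. \<psi> (G t)) -` ball 0 a)"
    using r(1) L1(1) L2(1) G0 \<phi>0 by simp
  ultimately obtain R where R: "R > 0"
    "ball 0 R \<subseteq> (ball 0 r \<inter> G -` ball 0 b) \<inter> (ball 0 r \<inter> (\<lambda>t. \<psi> (G t)) -` ball 0 a)"
    unfolding open_contains_ball by blast
  define \<gamma> where "\<gamma> t = \<psi> (G t)" for t
  define L where "L = L2 + 2 * L1"
  have Rsub: "t \<in> ball 0 r" "G t \<in> ball 0 b" "\<gamma> t \<in> ball 0 a" if "t \<in> ball 0 R" for t
    using R(2) that unfolding \<gamma>_def by auto
  have \<phi>\<gamma>: "\<phi> (\<gamma> t) = G t" if "t \<in> ball 0 R" for t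
    using GV[OF Rsub(1)[OF that]] inv by (simp add: \<gamma>_def)
  have "branch_chart C n y \<gamma> R L"
    unfolding branch_chart_def
  proof (intro conjI ballI)
    show "0 < R" "0 < L" using R L1 L2 by (simp_all add: L_def)
    show "\<gamma> 0 = 0" by (simp add: \<gamma>_def G0 \<phi>0)
    show "continuous_on (ball 0 R) \<gamma>"
      unfolding \<gamma>_def using Rsub(1) by (intro continuous_on_subset[OF cont\<gamma>]) auto
    show "inj_on \<gamma> (ball 0 R)"
    proof (rule inj_onI)
      fix t s :: complex assume ts: "t \<in> ball 0 R" "s \<in> ball 0 R" "\<gamma> t = \<gamma> s"
      then have "G t = G s" using \<phi>\<gamma> by metis
      then show "t = s" using inj Rsub(1) ts(1,2) unfolding G_def inj_on_def by blast
    qed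
    show "\<gamma> ` ball 0 R \<subseteq> C" using GV Rsub(1) by (auto simp: \<gamma>_def)
    show "\<exists>W. open W \<and> 0 \<in> W \<and> C \<inter> W \<subseteq> \<gamma> ` ball 0 R"
    proof (intro exI conjI)
      \<comment> \<open>In the ball of radius R^n the first coordinate t^n forces |t| < R, so the
        shrunken disc still covers a neighbourhood of 0 in C.\<close>
      show "open (U \<inter> \<phi> -` ball 0 (R ^ n))" by (rule continuous_open_preimage[OF cont(1) U(1)]) auto
      show "0 \<in> U \<inter> \<phi> -` ball 0 (R ^ n)" using U \<phi>0 R by simp
      show "C \<inter> (U \<inter> \<phi> -` ball 0 (R ^ n)) \<subseteq> \<gamma> ` ball 0 R"
      proof
        fix z assume z: "z \<in> C \<inter> (U \<inter> \<phi> -` ball 0 (R ^ n))"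
        then obtain t where t: "\<phi> z = G t" using img unfolding G_def by blast
        have "norm t ^ n \<le> norm (G t)"
          using norm_fst_le[of "t ^ n" "eval_fps y t"] by (simp add: G_def norm_power)
        also have "\<dots> < R ^ n" using z t by simp
        finally have "norm t < R" using R(1) by (intro power_less_imp_less_base[of _ n R]) auto
        moreover have "\<gamma> t = z" using z t inv(1)[of z] by (simp add: \<gamma>_def)
        ultimately show "z \<in> \<gamma> ` ball 0 R" by (intro image_eqI[of _ _ t]) auto
      qed
    qed
    fix t s :: complex assume ts: "t \<in> ball 0 R" "s \<in> ball 0 R"
    have "norm (\<gamma> t - \<gamma> s) \<le> L2 * norm (G t - G s)"
      unfolding \<gamma>_def by (intro L2 Rsub ts)
    also have "\<dots> \<le> L * branch_dist n y t s"
      using G_upper[of t s] L1 L2 by (intro mult_mono) (auto simp: L_def)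
    finally show "norm (\<gamma> t - \<gamma> s) \<le> L * branch_dist n y t s" .
    have "branch_dist n y t s \<le> 2 * norm (\<phi> (\<gamma> t) - \<phi> (\<gamma> s))"
      using G_lower[of t s] \<phi>\<gamma> ts by simp
    also have "\<dots> \<le> 2 * (L1 * norm (\<gamma> t - \<gamma> s))"
      by (intro mult_left_mono L1 Rsub ts) auto
    also have "\<dots> \<le> L * norm (\<gamma> t - \<gamma> s)"
      using L2 by (simp add: L_def distrib_right)
    finally show "branch_dist n y t s \<le> L * norm (\<gamma> t - \<gamma> s)" .
  qed
  then show thesis by (rule that)
qed

text \<open>\<open>R\<close> prescribes how small the image parameters are. It is kept apart from
  \<open>r'\<close> because the inverse of a chart is continuous on the image of a smaller compact
  disc, which later yields continuity of a map read in the parameters.\<close>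

lemma holder_map_in_charts:
  assumes C: "branch_chart C n y \<gamma> r L" and C': "branch_chart C' n' y' \<gamma>' r' L'" and n': "n' > 0"
    and U: "open U" "0 \<in> U" and f: "f ` (C \<inter> U) \<subseteq> C'" "f 0 = 0" "holder_on \<alpha> (C \<inter> U) f" "\<alpha> > 0"
    and R: "R > 0" "R \<le> r'"
  defines "h \<equiv> \<lambda>t. inv_into (ball 0 r') \<gamma>' (f (\<gamma> t))"
  obtains \<delta> c where "\<delta> > 0" "c > 0" "h 0 = 0"
    "\<And>t. t \<in> ball 0 \<delta> \<Longrightarrow> t \<in> ball 0 r \<and> \<gamma> t \<in> C \<inter> U \<and> h t \<in> ball 0 R \<and> \<gamma>' (h t) = f (\<gamma> t)"
    "\<And>t s. t \<in> ball 0 \<delta> \<Longrightarrow> s \<in> ball 0 \<delta> \<Longrightarrow> branch_dist n' y' (h t) (h s) \<le> c * branch_dist n y t s powr \<alpha>"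
proof -
  have r: "r > 0" "L > 0" "\<gamma> 0 = 0" "continuous_on (ball 0 r) \<gamma>" "\<gamma> ` ball 0 r \<subseteq> C"
    and up: "\<And>t s. t \<in> ball 0 r \<Longrightarrow> s \<in> ball 0 r \<Longrightarrow> norm (\<gamma> t - \<gamma> s) \<le> L * branch_dist n y t s"
    using C unfolding branch_chart_def by blast+
  obtain W where r': "r' > 0" "L' > 0" "\<gamma>' 0 = 0" "inj_on \<gamma>' (ball 0 r')"
    and W: "open W" "0 \<in> W" "C' \<inter> W \<subseteq> \<gamma>' ` ball 0 r'"
    and low: "\<And>t s. t \<in> ball 0 r' \<Longrightarrow> s \<in> ball 0 r' \<Longrightarrow> branch_dist n' y' t s \<le> L' * norm (\<gamma>' t - \<gamma>' s)"
    using C' unfolding branch_chart_def by blast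
  obtain c where c: "c > 0"
    "\<And>p q. p \<in> C \<inter> U \<Longrightarrow> q \<in> C \<inter> U \<Longrightarrow> norm (f p - f q) \<le> c * norm (p - q) powr \<alpha>"
    using f(3) unfolding holder_on_def by blast
  have 0: "0 \<in> C \<inter> U" using r U by (metis IntI centre_in_ball imageI subsetD)
  obtain \<rho> where \<rho>: "\<rho> > 0" "ball 0 \<rho> \<subseteq> W" using W open_contains_ball by blast
  \<comment> \<open>A point of C' of norm below \<tau> lies in the part covered by the chart, and L'
    \<tau> \<le> R^n' bounds its parameter. The radius \<kappa> solves c \<kappa>^\<alpha> =
    \<tau>.\<close>
  define \<tau> where "\<tau> = min \<rho> (R ^ n' / L')"
  have \<tau>: "\<tau> > 0" using \<rho> R r' by (simp add: \<tau>_def)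
  define \<kappa> where "\<kappa> = (\<tau> / c) powr (1 / \<alpha>)"
  have \<kappa>: "\<kappa> > 0" using \<tau> c by (simp add: \<kappa>_def)
  have "open (ball 0 r \<inter> \<gamma> -` (U \<inter> ball 0 \<kappa>))"
    by (rule continuous_open_preimage[OF r(4)]) (use U in auto)
  moreover have "0 \<in> ball 0 r \<inter> \<gamma> -` (U \<inter> ball 0 \<kappa>)" using r U \<kappa> by simp
  ultimately obtain \<delta> where \<delta>: "\<delta> > 0" "ball 0 \<delta> \<subseteq> ball 0 r \<inter> \<gamma> -` (U \<inter> ball 0 \<kappa>)"
    unfolding open_contains_ball by blast
  have \<delta>_sub: "t \<in> ball 0 r" "\<gamma> t \<in> C \<inter> U" "norm (\<gamma> t) < \<kappa>" if "t \<in> ball 0 \<delta>" for t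
    using \<delta>(2) r(5) that by (auto simp: subset_eq)
  have f_small: "norm (f (\<gamma> t)) < \<tau>" if t: "t \<in> ball 0 \<delta>" for t
  proof -
    have "norm (f (\<gamma> t)) \<le> c * norm (\<gamma> t) powr \<alpha>"
      using c(2)[OF \<delta>_sub(2)[OF t] 0] f(2) by simp
    also have "\<dots> < c * \<kappa> powr \<alpha>"
      using \<delta>_sub(3)[OF t] c(1) f(4) by (intro mult_strict_left_mono powr_less_mono2) auto
    also have "\<dots> = \<tau>" using c(1) f(4) \<tau> by (simp add: \<kappa>_def powr_powr)
    finally show ?thesis .
  qed
  have h: "h t \<in> ball 0 r'" "\<gamma>' (h t) = f (\<gamma> t)" if t: "t \<in> ball 0 \<delta>" for t
  proof -
    have "f (\<gamma> t) \<in> C' \<inter> W" using f(1) \<delta>_sub(2)[OF t] f_small[OF t] \<rho> by (auto simp: \<tau>_def)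
    then have "f (\<gamma> t) \<in> \<gamma>' ` ball 0 r'" using W(3) by blast
    then show "h t \<in> ball 0 r'" "\<gamma>' (h t) = f (\<gamma> t)"
      unfolding h_def by (rule inv_into_into, rule f_inv_into_f)
  qed
  have h0: "h 0 = 0"
    using inv_into_f_f[OF r'(4), of 0] r' r f by (simp add: h_def)
  have hR: "h t \<in> ball 0 R" if t: "t \<in> ball 0 \<delta>" for t
  proof -
    have "norm (h t) ^ n' \<le> branch_dist n' y' (h t) 0" by (rule norm_power_le_branch_dist_0[OF n'])
    also have "\<dots> \<le> L' * norm (f (\<gamma> t))"
      using low[OF h(1)[OF t], of 0] h(2)[OF t] r' by simp
    also have "\<dots> < L' * \<tau>" using f_small[OF t] r' by simp
    also have "\<dots> \<le> L' * (R ^ n' / L')" using r' by (intro mult_left_mono) (auto simp: \<tau>_def)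
    finally have "norm (h t) ^ n' < R ^ n'" using r' by simp
    then show ?thesis using R power_less_imp_less_base[of "norm (h t)" n' R] by simp
  qed
  show thesis
  proof (rule that[of \<delta> "L' * (c * L powr \<alpha>)"])
    fix t s :: complex assume t: "t \<in> ball 0 \<delta>" and s: "s \<in> ball 0 \<delta>"
    have "branch_dist n' y' (h t) (h s) \<le> L' * norm (f (\<gamma> t) - f (\<gamma> s))"
      using low[OF h(1)[OF t] h(1)[OF s]] h(2) t s by simp
    also have "\<dots> \<le> L' * (c * norm (\<gamma> t - \<gamma> s) powr \<alpha>)"
      using r' c(2)[OF \<delta>_sub(2)[OF t] \<delta>_sub(2)[OF s]] by (intro mult_left_mono) auto
    also have "\<dots> \<le> L' * (c * (L * branch_dist n y t s) powr \<alpha>)"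
      using r' c(1) f(4) up[OF \<delta>_sub(1)[OF t] \<delta>_sub(1)[OF s]]
      by (intro mult_left_mono powr_mono2) auto
    also have "\<dots> = L' * (c * L powr \<alpha>) * branch_dist n y t s powr \<alpha>"
      using r by (simp add: powr_mult branch_dist_nonneg)
    finally show "branch_dist n' y' (h t) (h s) \<le> L' * (c * L powr \<alpha>) * branch_dist n y t s powr \<alpha>" .
  qed (use \<delta> r r' c h h0 hR \<delta>_sub in auto)
qed

lemma holder_homeomorphic_imp_contact_gcd_le:
  assumes C: "branch_chart C n y \<gamma> r L" and C': "branch_chart C' n' y' \<gamma>' r' L'"
    and y: "fps_conv_radius y > 0" "n > 0" "\<And>k. fps_nth y k \<noteq> 0 \<Longrightarrow> n \<le> k"
    and y': "fps_conv_radius y' > 0" "n' > 0" "\<And>k. fps_nth y' k \<noteq> 0 \<Longrightarrow> n' \<le> k"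
    and \<alpha>: "\<alpha> > 0" "\<alpha>\<^sup>2 * q > 1" and hom: "holder_homeomorphic \<alpha> C 0 C' 0"
  shows "contact_gcd n y q \<le> contact_gcd n' y' (\<alpha>\<^sup>2 * q)"
proof -
  obtain U V f g where UV: "open U" "0 \<in> U" "open V" "0 \<in> V"
    and fg: "homeomorphism (C \<inter> U) (C' \<inter> V) f g" and f0: "f 0 = 0"
    and f: "holder_on \<alpha> (C \<inter> U) f" and g: "holder_on \<alpha> (C' \<inter> V) g"
    using hom unfolding holder_homeomorphic_def by blast
  have r: "r > 0" "\<gamma> 0 = 0" "continuous_on (ball 0 r) \<gamma>" "inj_on \<gamma> (ball 0 r)" "\<gamma> ` ball 0 r \<subseteq> C"
    using C unfolding branch_chart_def by blast+
  have r': "r' > 0" "continuous_on (ball 0 r') \<gamma>'"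
    using C' unfolding branch_chart_def by blast+
  have fgeq: "\<And>z. z \<in> C \<inter> U \<Longrightarrow> g (f z) = z" and img: "f ` (C \<inter> U) = C' \<inter> V" "g ` (C' \<inter> V) = C \<inter> U"
    and contg: "continuous_on (C' \<inter> V) g"
    using fg by (auto simp: homeomorphism_def)
  have "0 \<in> C \<inter> U" using r UV by (metis IntI centre_in_ball imageI subsetD)
  then have g0: "g 0 = 0" using fgeq[of 0] f0 by simp
  define h where "h t = inv_into (ball 0 r') \<gamma>' (f (\<gamma> t))" for t
  define k where "k t = inv_into (ball 0 r) \<gamma> (g (\<gamma>' t))" for t
  obtain \<delta>1 c1 where h: "\<delta>1 > 0" "c1 > 0" "h 0 = 0"
    "\<And>t. t \<in> ball 0 \<delta>1 \<Longrightarrow> t \<in> ball 0 r \<and> \<gamma> t \<in> C \<inter> U \<and> h t \<in> ball 0 r' \<and> \<gamma>' (h t) = f (\<gamma> t)"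
    "\<And>t s. t \<in> ball 0 \<delta>1 \<Longrightarrow> s \<in> ball 0 \<delta>1 \<Longrightarrow> branch_dist n' y' (h t) (h s) \<le> c1 * branch_dist n y t s powr \<alpha>"
    using holder_map_in_charts[OF C C' y'(2) UV(1,2) _ f0 f \<alpha>(1) r'(1) order_refl] img
    unfolding h_def by blast
  \<comment> \<open>With image parameters in the disc of radius r / 2, the values of g stay in the
    image of a compact disc under \<gamma>. There the injective continuous \<gamma> has a continuous
    inverse, which makes \<open>k\<close> continuous.\<close>
  have half: "r / 2 > 0" "r / 2 \<le> r" using r by auto
  obtain \<delta>2 c2 where k: "\<delta>2 > 0" "c2 > 0" "k 0 = 0"
    "\<And>t. t \<in> ball 0 \<delta>2 \<Longrightarrow> t \<in> ball 0 r' \<and> \<gamma>' t \<in> C' \<inter> V \<and> k t \<in> ball 0 (r / 2) \<and> \<gamma> (k t) = g (\<gamma>' t)"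
    "\<And>t s. t \<in> ball 0 \<delta>2 \<Longrightarrow> s \<in> ball 0 \<delta>2 \<Longrightarrow> branch_dist n y (k t) (k s) \<le> c2 * branch_dist n' y' t s powr \<alpha>"
    using holder_map_in_charts[OF C' C y(2) UV(3,4) _ g0 g \<alpha>(1) half] img
    unfolding k_def by blast
  define \<delta> where "\<delta> = min \<delta>1 \<delta>2"
  define c where "c = max c1 c2"
  show ?thesis
  proof (rule contact_gcd_le[OF y y' \<alpha>, of \<delta> c h k])
    show "\<delta> > 0" "c > 0" using h k by (auto simp: \<delta>_def c_def)
    show "h 0 = 0" "k 0 = 0" by fact+
    show "branch_dist n' y' (h t) (h s) \<le> c * branch_dist n y t s powr \<alpha>"
      if "t \<in> ball 0 \<delta>" "s \<in> ball 0 \<delta>" for t s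
    proof -
      have "branch_dist n' y' (h t) (h s) \<le> c1 * branch_dist n y t s powr \<alpha>"
        using that by (intro h) (auto simp: \<delta>_def)
      also have "\<dots> \<le> c * branch_dist n y t s powr \<alpha>" by (intro mult_right_mono) (auto simp: c_def)
      finally show ?thesis .
    qed
    show "branch_dist n y (k t) (k s) \<le> c * branch_dist n' y' t s powr \<alpha>"
      if "t \<in> ball 0 \<delta>" "s \<in> ball 0 \<delta>" for t s
    proof -
      have "branch_dist n y (k t) (k s) \<le> c2 * branch_dist n' y' t s powr \<alpha>"
        using that by (intro k) (auto simp: \<delta>_def)
      also have "\<dots> \<le> c * branch_dist n' y' t s powr \<alpha>" by (intro mult_right_mono) (auto simp: c_def)
      finally show ?thesis .
    qed
    show "k (h t) = t" if "t \<in> ball 0 \<delta>" "h t \<in> ball 0 \<delta>" for t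
    proof -
      have "t \<in> ball 0 \<delta>1" using that by (simp add: \<delta>_def)
      note h(4)[OF this]
      then have "g (\<gamma>' (h t)) = \<gamma> t" "t \<in> ball 0 r" using fgeq by auto
      then show ?thesis using inv_into_f_f[OF r(4)] by (simp add: k_def)
    qed
    show "continuous_on (ball 0 \<delta>) k"
      unfolding k_def
    proof (rule continuous_on_compose2[of "\<gamma> ` cball 0 (r / 2)"])
      have sub: "cball 0 (r / 2) \<subseteq> ball (0::complex) r" using r(1) by auto
      show "continuous_on (\<gamma> ` cball 0 (r / 2)) (inv_into (ball 0 r) \<gamma>)"
        using sub inv_into_f_f[OF r(4)]
        by (intro continuous_on_inv continuous_on_subset[OF r(3)]) auto
      have "continuous_on (ball 0 \<delta>) \<gamma>'"
        using k(4) by (intro continuous_on_subset[OF r'(2)]) (auto simp: \<delta>_def)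
      then show "continuous_on (ball 0 \<delta>) (\<lambda>t. g (\<gamma>' t))"
        using k(4) by (intro continuous_on_compose2[OF contg]) (auto simp: \<delta>_def)
      show "(\<lambda>t. g (\<gamma>' t)) ` ball 0 \<delta> \<subseteq> \<gamma> ` cball 0 (r / 2)"
      proof (rule image_subsetI)
        fix t assume "t \<in> ball (0::complex) \<delta>"
        then have "t \<in> ball 0 \<delta>2" by (simp add: \<delta>_def)
        note k(4)[OF this]
        then show "g (\<gamma>' t) \<in> \<gamma> ` cball 0 (r / 2)" by (intro image_eqI[of _ _ "k t"]) auto
      qed
    qed
  qed
qed

section \<open>Multiplicity and the order of the parametrization\<close>

text \<open>\<open>root_near_1\<close> is an exponential and never 0, so the origin needs its own
  case; with the value 0 the function is also continuous there.\<close>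

definition nth_root :: "nat \<Rightarrow> complex \<Rightarrow> complex" where
  "nth_root n x = (if x = 0 then 0 else root_near_1 n x)"

lemma nth_root_power: "n > 0 \<Longrightarrow> nth_root n x ^ n = x"
  by (simp add: nth_root_def root_near_1_power)

text \<open>
  The product does not depend on the (discontinuous) choice of the root, see
  \<open>conjugate_product_root\<close>; this is why it is holomorphic in both variables.
\<close>

definition conjugate_product :: "nat \<Rightarrow> complex fps \<Rightarrow> complex \<times> complex \<Rightarrow> complex" where
  "conjugate_product n y p = (\<Prod>\<zeta> | \<zeta> ^ n = 1. snd p - eval_fps y (\<zeta> * nth_root n (fst p)))"

text \<open>Two n-th roots of the same nonzero x differ by a root of unity, and multiplication by it
  permutes the factors.\<close>

lemma conjugate_product_root:
  assumes "n > 0" "t ^ n = x"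
  shows "conjugate_product n y (x, w) = (\<Prod>\<zeta> | \<zeta> ^ n = 1. w - eval_fps y (\<zeta> * t))"
proof (cases "x = 0")
  case True
  then have "t = 0" using assms by simp
  then show ?thesis using True by (simp add: conjugate_product_def nth_root_def)
next
  case False
  define s where "s = nth_root n x"
  have s: "s ^ n = x" using nth_root_power[OF assms(1)] by (simp add: s_def)
  have ne: "s \<noteq> 0" "t \<noteq> 0" using False assms s by (auto simp: zero_power)
  have "(\<Prod>\<zeta> | \<zeta> ^ n = 1. w - eval_fps y (\<zeta> * s)) = (\<Prod>\<zeta> | \<zeta> ^ n = 1. w - eval_fps y (\<zeta> * t))"
    by (rule prod.reindex_bij_witness[of _ "\<lambda>\<zeta>. \<zeta> * (t / s)" "\<lambda>\<zeta>. \<zeta> * (s / t)"])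
      (use ne s assms False in \<open>auto simp: power_mult_distrib power_divide\<close>)
  then show ?thesis by (simp add: conjugate_product_def s_def)
qed

lemma conjugate_product_eq_0_iff:
  assumes "n > 0"
  shows "conjugate_product n y (x, w) = 0 \<longleftrightarrow> (\<exists>t. t ^ n = x \<and> eval_fps y t = w)"
proof
  have fin: "finite {\<zeta>::complex. \<zeta> ^ n = 1}" using assms finite_roots_unity[of n] by simp
  assume "conjugate_product n y (x, w) = 0"
  then obtain \<zeta> where "\<zeta> ^ n = 1" "w = eval_fps y (\<zeta> * nth_root n x)"
    unfolding conjugate_product_def prod_zero_iff[OF fin] by auto
  then show "\<exists>t. t ^ n = x \<and> eval_fps y t = w"
    using nth_root_power[OF assms] by (intro exI[of _ "\<zeta> * nth_root n x"]) (simp add: power_mult_distrib)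
next
  assume "\<exists>t. t ^ n = x \<and> eval_fps y t = w"
  then obtain t where t: "t ^ n = x" "eval_fps y t = w" by blast
  have "finite {\<zeta>::complex. \<zeta> ^ n = 1}" using assms finite_roots_unity by auto
  then show "conjugate_product n y (x, w) = 0"
    unfolding conjugate_product_root[OF assms t(1)] using t(2) by (intro prod_zero bexI[of _ 1]) auto
qed

lemma norm_less_of_power_mem_ball:
  fixes t :: complex
  assumes "t ^ n \<in> ball 0 (r ^ n)" "r > 0"
  shows "norm t < r"
  using assms power_less_imp_less_base[of "norm t" n r] by (simp add: norm_power)

lemma eval_fps_holomorphic_on_ball:
  fixes y :: "complex fps"
  assumes "ereal r \<le> fps_conv_radius y"
  shows "eval_fps y holomorphic_on ball 0 r"
proof (rule holomorphic_on_eval_fps)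
  have "ereal (norm t) < fps_conv_radius y" if "t \<in> ball 0 r" for t :: complex
    using less_le_trans[OF _ assms, of "ereal (norm t)"] that by simp
  then show "ball 0 r \<subseteq> eball (0::complex) (fps_conv_radius y)" by auto
qed

text \<open>The modulus of the root is determined by |x|, so the jump along the cut does no harm at
  the origin.\<close>

lemma isCont_nth_root_0:
  assumes "n > 0"
  shows "isCont (nth_root n) 0"
proof -
  have "norm (nth_root n x) < e" if "e > 0" "norm x < e ^ n" for e x
    using norm_less_of_power_mem_ball[of "nth_root n x" n e] nth_root_power[OF assms] that by simp
  then have "(nth_root n \<longlongrightarrow> 0) (nhds 0)"
    unfolding tendsto_iff eventually_nhds_metric using assms
    by (metis dist_0_norm dist_commute zero_less_power)
  then show ?thesis by (simp add: isCont_def nth_root_def tendsto_nhds_iff)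
qed

section \<open>Division by zeros in one variable\<close>

lemma holomorphic_on_quotient_finite_zeros:
  fixes f p q :: "complex \<Rightarrow> complex"
  assumes "open S" "continuous_on S q" "f holomorphic_on S" "p holomorphic_on S"
    and "\<And>z. z \<in> S \<Longrightarrow> f z = q z * p z" "finite {z\<in>S. p z = 0}"
  shows "q holomorphic_on S"
proof (rule no_isolated_singularity[OF assms(2) _ assms(1,6)])
  have "(\<lambda>z. f z / p z) holomorphic_on (S - {z\<in>S. p z = 0})"
    using assms(3,4) by (intro holomorphic_on_divide) (auto intro: holomorphic_on_subset)
  then show "q holomorphic_on (S - {z\<in>S. p z = 0})"
    by (rule holomorphic_transform) (use assms(5) in auto)
qed

text \<open>Zeros are divided out one at a time. A further zero a of f is a zero of the current
  quotient, because the factors already split off do not vanish at a.\<close>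

lemma holomorphic_factor_distinct_zeros:
  fixes f :: "complex \<Rightarrow> complex"
  assumes "finite A" "A \<subseteq> S" "open S" "f holomorphic_on S" "\<And>a. a \<in> A \<Longrightarrow> f a = 0"
  obtains q where "q holomorphic_on S" "\<And>z. z \<in> S \<Longrightarrow> f z = (\<Prod>a\<in>A. z - a) * q z"
  using assms
proof (induction A arbitrary: thesis rule: finite_induct)
  case empty
  show ?case by (rule empty(1)[of f]) (use empty in auto)
next
  case (insert a A)
  obtain q where q: "q holomorphic_on S" "\<And>z. z \<in> S \<Longrightarrow> f z = (\<Prod>a\<in>A. z - a) * q z"
    using insert.IH insert.prems by (metis insert_subset insertCI)
  define q' where "q' z = (if z = a then deriv q a else (q z - q a) / (z - a))" for z
  have "a \<in> S" using insert.prems by auto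
  moreover have "(\<Prod>b\<in>A. a - b) \<noteq> 0" using insert.hyps by auto
  ultimately have "q a = 0" using q(2)[of a] insert.prems by auto
  show ?case
  proof (rule insert.prems(1)[of q'])
    show "q' holomorphic_on S"
      unfolding q'_def using \<open>a \<in> S\<close> insert.prems(3) q(1) by (intro pole_lemma) (auto simp: interior_open)
    fix z assume "z \<in> S"
    have "q z = (z - a) * q' z" using \<open>q a = 0\<close> by (auto simp: q'_def)
    then show "f z = (\<Prod>a\<in>insert a A. z - a) * q' z"
      using q(2)[OF \<open>z \<in> S\<close>] insert.hyps by simp
  qed
qed

section \<open>Holomorphy of the conjugate product and division by it\<close>

context
  fixes y :: "complex fps" and n :: nat and r :: real
  assumes n: "n > 0" and r: "r > 0" "ereal r \<le> fps_conv_radius y"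
begin

lemma conjugate_product_local_root:
  assumes "x0 \<noteq> 0" "x \<in> ball x0 (norm x0 / 2)"
  shows "(nth_root n x0 * root_near_1 n (x / x0)) ^ n = x" "x / x0 \<in> ball 1 (1/2)"
proof -
  have "norm (x / x0 - 1) = norm (x - x0) / norm x0"
    using assms(1) by (simp add: field_simps flip: norm_divide)
  also have "\<dots> < 1/2" using assms by (simp add: dist_norm field_simps norm_minus_commute)
  finally show *: "x / x0 \<in> ball 1 (1/2)" by (simp add: dist_norm norm_minus_commute)
  show "(nth_root n x0 * root_near_1 n (x / x0)) ^ n = x"
    using assms(1) ball_1_half(1)[OF *] n
    by (simp add: power_mult_distrib nth_root_power root_near_1_power)
qed

text \<open>Over 0, continuity of \<open>nth_root\<close> at 0 is enough. Over other points
  \<open>nth_root\<close> may cross its cut, so it is replaced by the local holomorphic root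
  \<open>T\<close>, which does not change the product.\<close>

lemma continuous_on_conjugate_product:
  "continuous_on (ball 0 (r ^ n) \<times> UNIV) (conjugate_product n y)"
proof (rule continuous_at_imp_continuous_on, clarify)
  fix x0 w0 :: complex assume x0: "x0 \<in> ball 0 (r ^ n)"
  have contY: "isCont (eval_fps y) t" if "norm t < r" for t
    using eval_fps_holomorphic_on_ball[OF r(2)] that
    by (meson continuous_on_eq_continuous_at holomorphic_on_imp_continuous_on open_ball mem_ball_0)
  show "isCont (conjugate_product n y) (x0, w0)"
  proof (cases "x0 = 0")
    case True
    have factor: "isCont (\<lambda>p. snd p - eval_fps y (\<zeta> * nth_root n (fst p))) (0, w0)" for \<zeta>
    proof -
      have "isCont (\<lambda>p::complex \<times> complex. nth_root n (fst p)) (0, w0)"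
        by (rule isCont_o2[where f = fst]) (use isCont_nth_root_0[OF n] in \<open>auto intro: continuous_intros\<close>)
      then have "isCont (\<lambda>p::complex \<times> complex. \<zeta> * nth_root n (fst p)) (0, w0)"
        by (intro continuous_intros)
      moreover have "isCont (eval_fps y) (\<zeta> * nth_root n (fst (0, w0)))"
        by (rule contY) (use r in \<open>simp add: nth_root_def\<close>)
      ultimately have "isCont (\<lambda>p::complex \<times> complex. eval_fps y (\<zeta> * nth_root n (fst p))) (0, w0)"
        by (rule isCont_o2)
      then show ?thesis by (intro continuous_intros)
    qed
    then show ?thesis unfolding True conjugate_product_def[abs_def] by (intro continuous_prod factor)
  next
    case False
    define B where "B = (ball x0 (norm x0 / 2) \<inter> ball 0 (r ^ n)) \<times> (UNIV :: complex set)"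
    define T where "T x = nth_root n x0 * root_near_1 n (x / x0)" for x
    have T: "T x ^ n = x" if "x \<in> ball x0 (norm x0 / 2)" for x
      unfolding T_def by (rule conjugate_product_local_root[OF False that])
    have contT: "continuous_on B (\<lambda>p. T (fst p))"
      unfolding T_def B_def
      by (intro continuous_intros continuous_on_compose2[OF continuous_on_root_near_1[OF n]])
        (use False conjugate_product_local_root(2)[OF False] in auto)
    have factor: "continuous_on B (\<lambda>p. snd p - eval_fps y (\<zeta> * T (fst p)))" if \<zeta>: "\<zeta> ^ n = 1" for \<zeta>
    proof -
      have "\<zeta> * T (fst p) \<in> ball 0 r" if "p \<in> B" for p
      proof -
        have "(\<zeta> * T (fst p)) ^ n \<in> ball 0 (r ^ n)"
          using T[of "fst p"] \<zeta> that by (auto simp: B_def power_mult_distrib)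
        then show ?thesis using norm_less_of_power_mem_ball r(1) by simp
      qed
      then have "continuous_on B (\<lambda>p. eval_fps y (\<zeta> * T (fst p)))"
        by (intro continuous_on_compose2[OF holomorphic_on_imp_continuous_on[OF eval_fps_holomorphic_on_ball[OF r(2)]]]
            continuous_on_mult_left contT) blast
      then show ?thesis by (rule continuous_on_diff[rotated]) (intro continuous_intros)
    qed
    have "continuous_on B (\<lambda>p. \<Prod>\<zeta> | \<zeta> ^ n = 1. snd p - eval_fps y (\<zeta> * T (fst p)))"
      by (intro continuous_on_prod factor) simp
    then have "continuous_on B (conjugate_product n y)"
    proof (rule continuous_on_eq)
      fix p assume "p \<in> B"
      then show "(\<Prod>\<zeta> | \<zeta> ^ n = 1. snd p - eval_fps y (\<zeta> * T (fst p))) = conjugate_product n y p"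
        using conjugate_product_root[OF n T, of "fst p" y "snd p"] by (auto simp: B_def)
    qed
    moreover have "open B" "(x0, w0) \<in> B"
      using False x0 by (auto simp: B_def intro!: open_Times)
    ultimately show ?thesis by (simp add: continuous_on_eq_continuous_at)
  qed
qed

lemma conjugate_product_holomorphic_on_snd: "(\<lambda>w. conjugate_product n y (x, w)) holomorphic_on S"
  unfolding conjugate_product_def by (intro holomorphic_intros) auto

text \<open>Off 0 the root can locally be chosen holomorphic; at 0, where it branches, continuity of
  the product removes the singularity.\<close>

lemma conjugate_product_holomorphic_on_fst:
  "(\<lambda>x. conjugate_product n y (x, w)) holomorphic_on ball 0 (r ^ n)"
proof (rule no_isolated_singularity[where K = "{0}"])
  show "continuous_on (ball 0 (r ^ n)) (\<lambda>x. conjugate_product n y (x, w))"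
    by (rule continuous_on_compose2[OF continuous_on_conjugate_product]) (auto intro!: continuous_intros)
  show "(\<lambda>x. conjugate_product n y (x, w)) holomorphic_on ball 0 (r ^ n) - {0}"
  proof (subst holomorphic_on_open, simp add: open_Diff, intro ballI)
    fix x0 assume x0: "x0 \<in> ball 0 (r ^ n) - {0::complex}"
    define B where "B = ball x0 (norm x0 / 2) \<inter> ball 0 (r ^ n)"
    define T where "T x = nth_root n x0 * root_near_1 n (x / x0)" for x
    have x0ne: "x0 \<noteq> 0" using x0 by simp
    have T: "T x ^ n = x" if "x \<in> ball x0 (norm x0 / 2)" for x
      unfolding T_def by (rule conjugate_product_local_root[OF x0ne that])
    have root_hol: "root_near_1 n holomorphic_on ball 1 (1/2)"
      using has_field_derivative_root_near_1[OF n] unfolding holomorphic_on_open[OF open_ball] by blast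
    have "((root_near_1 n) \<circ> (\<lambda>x. x / x0)) holomorphic_on B"
      by (rule holomorphic_on_compose_gen[OF _ root_hol])
        (use conjugate_product_local_root(2)[OF x0ne] x0ne in \<open>auto simp: B_def intro!: holomorphic_intros\<close>)
    then have holT: "T holomorphic_on B"
      unfolding T_def o_def by (intro holomorphic_intros)
    have "(\<lambda>x. \<Prod>\<zeta> | \<zeta> ^ n = 1. w - (eval_fps y \<circ> (\<lambda>x. \<zeta> * T x)) x) holomorphic_on B"
    proof (intro holomorphic_intros holomorphic_on_compose_gen[OF _ eval_fps_holomorphic_on_ball[OF r(2)]] holT)
      fix \<zeta> :: complex assume "\<zeta> \<in> {\<zeta>. \<zeta> ^ n = 1}"
      then have \<zeta>: "\<zeta> ^ n = 1" by simp
      show "(\<lambda>x. \<zeta> * T x) ` B \<subseteq> ball 0 r"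
      proof (rule image_subsetI)
        fix x assume "x \<in> B"
        then have "(\<zeta> * T x) ^ n \<in> ball 0 (r ^ n)"
          using T[of x] \<zeta> by (auto simp: B_def power_mult_distrib)
        then show "\<zeta> * T x \<in> ball 0 r" using norm_less_of_power_mem_ball r(1) by simp
      qed
    qed
    then have "(\<lambda>x. conjugate_product n y (x, w)) holomorphic_on B"
      by (rule holomorphic_transform) (use conjugate_product_root[OF n T] in \<open>auto simp: B_def\<close>)
    moreover have "open B" "x0 \<in> B" using x0 by (auto simp: B_def)
    ultimately show "\<exists>f'. ((\<lambda>x. conjugate_product n y (x, w)) has_field_derivative f') (at x0)"
      by (auto simp: holomorphic_on_open)
  qed
qed auto

lemma conjugate_product_holomorphic2_on: "conjugate_product n y holomorphic2_on (ball 0 (r ^ n) \<times> UNIV)"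
proof (rule holomorphic2_onI[OF _ continuous_on_conjugate_product])
  fix x w :: complex assume "(x, w) \<in> ball 0 (r ^ n) \<times> UNIV"
  then show "(\<lambda>x. conjugate_product n y (x, w)) field_differentiable at x"
    using holomorphic_on_imp_differentiable_at[OF conjugate_product_holomorphic_on_fst] by auto
  show "(\<lambda>w. conjugate_product n y (x, w)) field_differentiable at w"
    using holomorphic_on_imp_differentiable_at[OF conjugate_product_holomorphic_on_snd[of _ UNIV]] by auto
qed (auto intro: open_Times)

lemma finite_conjugate_product_zeros_snd: "finite {w. conjugate_product n y (x, w) = 0}"
proof -
  have "{w. conjugate_product n y (x, w) = 0} = eval_fps y ` {t. t ^ n = x}"
    using conjugate_product_eq_0_iff[OF n] by auto
  then show ?thesis using finite_nth_roots[OF n] by simp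
qed

text \<open>Zeros with |x| < a^n come from solutions of y(t) = w in the compact disc |t| \<le> a.
  There are finitely many of these since y is not constant: its value at 0 is 0 but the series is
  not 0.\<close>

lemma finite_conjugate_product_zeros_fst:
  assumes "y \<noteq> 0" "eval_fps y 0 = 0" "a < r" "a > 0"
  shows "finite {x \<in> ball 0 (a ^ n). conjugate_product n y (x, w) = 0}"
proof -
  have "\<not> (\<lambda>t. eval_fps y t - w) constant_on ball 0 r"
  proof
    assume "(\<lambda>t. eval_fps y t - w) constant_on ball 0 r"
    then have const: "eval_fps y t = 0" if "t \<in> ball 0 r" for t
      using that r(1) assms(2) unfolding constant_on_def by (metis centre_in_ball diff_add_cancel)
    have "fps_conv_radius y > 0" using r by (metis ereal_less(2) less_le_trans)
    then have "eval_fps y has_fps_expansion y" by (rule eval_fps_has_fps_expansion)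
    then obtain c d where cd: "c > 0" "d > 0" "\<And>t. norm t < d \<Longrightarrow> norm (eval_fps y t) \<ge> c * norm t ^ subdegree y"
      using has_fps_expansion_lower_bound[OF _ assms(1)] by metis
    define t where "t = complex_of_real (min r d / 2)"
    have t: "0 < norm t" "norm t < r" "norm t < d" using r(1) cd(2) by (auto simp: t_def)
    then have "c * norm t ^ subdegree y \<le> 0" using cd(3)[of t] const[of t] by simp
    then show False using cd(1) t(1) by (metis mult_pos_pos not_less zero_less_power)
  qed
  then have "finite {t \<in> cball 0 a. eval_fps y t - w = 0}"
    using assms(3) eval_fps_holomorphic_on_ball[OF r(2)]
    by (intro holomorphic_compact_finite_zeros[of _ "ball 0 r"]) (auto intro!: holomorphic_intros)
  moreover have "{x \<in> ball 0 (a ^ n). conjugate_product n y (x, w) = 0} \<subseteq>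
      (\<lambda>t. t ^ n) ` {t \<in> cball 0 a. eval_fps y t - w = 0}"
  proof
    fix x assume "x \<in> {x \<in> ball 0 (a ^ n). conjugate_product n y (x, w) = 0}"
    then obtain t where "t ^ n = x" "eval_fps y t = w" "t ^ n \<in> ball 0 (a ^ n)"
      using conjugate_product_eq_0_iff[OF n] by auto
    then show "x \<in> (\<lambda>t. t ^ n) ` {t \<in> cball 0 a. eval_fps y t - w = 0}"
      using norm_less_of_power_mem_ball[of t n a] assms(4) by (intro image_eqI[of _ _ t]) auto
  qed
  ultimately show ?thesis by (rule finite_surj)
qed

text \<open>Let P be the conjugate product. For x \<noteq> 0 the values y(t) with t^n = x are n
  distinct zeros of F(x, .), so F / P extends holomorphically in w. At x = 0 these zeros collide;
  the Cauchy integral of F / P over |u| = \<rho>, where P has no zeros, defines the quotient there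
  as well and makes it jointly continuous. The zeros of P on coordinate lines are finite in number,
  so the quotient is holomorphic in each variable.\<close>

lemma branch_divides_vanishing_function:
  assumes inj: "inj_on (\<lambda>t. (t ^ n, eval_fps y t)) (ball 0 r)" and y: "y \<noteq> 0" "eval_fps y 0 = 0"
    and F: "F holomorphic2_on N" "open N" "0 \<in> N"
    and vanish: "\<And>t. t \<in> ball 0 r \<Longrightarrow> F (t ^ n, eval_fps y t) = 0"
  obtains a \<rho> Q where "a > 0" "\<rho> > 0" "a \<le> r ^ n" "Q holomorphic2_on (ball 0 a \<times> ball 0 \<rho>)"
    "\<And>p. p \<in> ball 0 a \<times> ball 0 \<rho> \<Longrightarrow> F p = Q p * conjugate_product n y p"
proof -
  obtain b where b: "b > 0" "cball 0 b \<times> cball 0 b \<subseteq> N"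
    using cball_Times_subset_open[of N 0 0] F(2,3) by (auto simp: zero_prod_def)
  define \<rho> where "\<rho> = b / 2"
  have \<rho>: "\<rho> > 0" "\<rho> < b" using b by (auto simp: \<rho>_def)
  have "isCont (eval_fps y) 0"
    using eval_fps_holomorphic_on_ball[OF r(2)] r(1)
    by (meson continuous_on_eq_continuous_at holomorphic_on_imp_continuous_on open_ball centre_in_ball)
  then have "\<exists>d>0. \<forall>t. norm t < d \<longrightarrow> norm (eval_fps y t) < \<rho>"
    using \<rho>(1) y(2) unfolding continuous_at_eps_delta by auto
  then obtain d where d: "d > 0" "\<And>t. norm t < d \<Longrightarrow> norm (eval_fps y t) < \<rho>"
    by blast
  \<comment> \<open>s \<le> d puts all values y(t) over |x| < s^n inside |w| < \<rho>, so P has no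
    zeros on the circle; s \<le> 1 and s \<le> b give a = s^n \<le> b.\<close>
  define s where "s = min (min d (r / 2)) (min 1 b)"
  have s: "s > 0" "s \<le> d" "s < r" "s \<le> 1" "s \<le> b" using d r b by (auto simp: s_def)
  define a where "a = s ^ n"
  have a: "a > 0" "a \<le> r ^ n" "a \<le> b"
    using s power_mono[of s r n] power_decreasing[of 1 n s] n by (auto simp: a_def)
  have root_small: "norm t < s" if "t ^ n \<in> ball 0 a" for t :: complex
    using norm_less_of_power_mem_ball that s(1) by (simp add: a_def)
  let ?P = "conjugate_product n y"
  have box: "ball 0 a \<times> ball 0 b \<subseteq> N" using a b by auto
  have P_nonzero: "?P (x, u) \<noteq> 0" if "x \<in> ball 0 a" "norm u = \<rho>" for x u
  proof
    assume "?P (x, u) = 0"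
    then obtain t where "t ^ n = x" "eval_fps y t = u"
      using conjugate_product_eq_0_iff[OF n] by blast
    then show False using root_small[of t] d(2)[of t] s that by auto
  qed
  have contP: "continuous_on (ball 0 a \<times> T) ?P" for T
    using a by (intro continuous_on_subset[OF continuous_on_conjugate_product]) auto
  have contF: "continuous_on (ball 0 a \<times> ball 0 b) F"
    using holomorphic2_imp_continuous_on[OF F(1)] box by (rule continuous_on_subset)
  define H where "H p = F p / ?P p" for p
  define Q where "Q p = 1 / (2 * of_real pi * \<i>) *
      contour_integral (circlepath 0 \<rho>) (\<lambda>u. H (fst p, u) / (u - snd p) ^ 1)" for p
  have "continuous_on (ball 0 a \<times> sphere 0 \<rho>) H"
    unfolding H_def using \<rho> P_nonzero
    by (intro continuous_on_divide contP continuous_on_subset[OF contF]) auto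
  then have contQ: "continuous_on (ball 0 a \<times> ball 0 \<rho>) Q"
    unfolding Q_def by (intro continuous_intros continuous_on_circlepath_kernel \<rho>)
  have eq_nonzero: "F (x, w) = Q (x, w) * ?P (x, w)" if x: "x \<in> ball 0 a" "x \<noteq> 0" and w: "w \<in> ball 0 \<rho>" for x w
  proof -
    define S where "S = {t. t ^ n = x}"
    have S_small: "t \<in> ball 0 r" "eval_fps y t \<in> ball 0 b" "F (x, eval_fps y t) = 0" if "t \<in> S" for t
    proof -
      have "norm t < s" using root_small[of t] that x by (auto simp: S_def)
      then show "t \<in> ball 0 r" "eval_fps y t \<in> ball 0 b" using s d(2)[of t] \<rho> by auto
      then show "F (x, eval_fps y t) = 0" using vanish[of t] that by (auto simp: S_def)
    qed
    have injS: "inj_on (eval_fps y) S"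
      using inj S_small(1) unfolding inj_on_def S_def by blast
    have holF: "(\<lambda>u. F (x, u)) holomorphic_on ball 0 b"
      unfolding holomorphic_on_def using x box
      by (intro ballI field_differentiable_at_within[OF holomorphic2_along_curve[OF F(1)]]) auto
    have finS: "finite (eval_fps y ` S)" using finite_nth_roots[OF n] by (simp add: S_def)
    have subS: "eval_fps y ` S \<subseteq> ball 0 b" using S_small(2) by (rule image_subsetI)
    have zeroS: "F (x, v) = 0" if "v \<in> eval_fps y ` S" for v using that S_small(3) by blast
    obtain q where q: "q holomorphic_on ball 0 b"
      "\<And>u. u \<in> ball 0 b \<Longrightarrow> F (x, u) = (\<Prod>v\<in>eval_fps y ` S. u - v) * q u"
      using holomorphic_factor_distinct_zeros[OF finS subS open_ball holF zeroS] by blast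
    have prod_eq: "?P (x, u) = (\<Prod>v\<in>eval_fps y ` S. u - v)" for u
    proof -
      define t where "t = nth_root n x"
      have t: "t ^ n = x" using nth_root_power[OF n] by (simp add: t_def)
      then have "t \<noteq> 0" using x(2) n by (auto simp: zero_power)
      have "?P (x, u) = (\<Prod>\<zeta> | \<zeta> ^ n = 1. u - eval_fps y (\<zeta> * t))"
        by (rule conjugate_product_root[OF n t])
      also have "\<dots> = (\<Prod>v\<in>S. u - eval_fps y v)"
        by (rule prod.reindex_bij_witness[of _ "\<lambda>v. v / t" "\<lambda>\<zeta>. \<zeta> * t"])
          (use t \<open>t \<noteq> 0\<close> x(2) in \<open>auto simp: S_def power_mult_distrib power_divide\<close>)
      also have "\<dots> = (\<Prod>v\<in>eval_fps y ` S. u - v)"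
        using prod.reindex[OF injS, of "\<lambda>v. u - v"] by (simp add: o_def)
      finally show ?thesis .
    qed
    have "((\<lambda>u. q u / (u - w)) has_contour_integral (2 * of_real pi * \<i> * q w)) (circlepath 0 \<rho>)"
      using w \<rho> by (intro Cauchy_integral_circlepath_simple holomorphic_on_subset[OF q(1)]) auto
    then have "((\<lambda>u. H (x, u) / (u - w) ^ 1) has_contour_integral (2 * of_real pi * \<i> * q w)) (circlepath 0 \<rho>)"
    proof (rule has_contour_integral_eq)
      fix u assume "u \<in> path_image (circlepath 0 \<rho>)"
      then have u: "norm u = \<rho>" using \<rho> by simp
      have "H (x, u) = q u"
        using q(2)[of u] P_nonzero[OF x(1) u] u \<rho> by (simp add: H_def prod_eq)
      then show "q u / (u - w) = H (x, u) / (u - w) ^ 1" by simp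
    qed
    then have "Q (x, w) = q w" by (simp add: Q_def contour_integral_unique)
    then show ?thesis using q(2)[of w] w \<rho> by (simp add: prod_eq)
  qed
  have eq: "F (x, w) = Q (x, w) * ?P (x, w)" if x: "x \<in> ball 0 a" and w: "w \<in> ball 0 \<rho>" for x w
  proof (cases "x = 0")
    case True
    \<comment> \<open>The identity extends from x \<noteq> 0 to x = 0 because both sides are
      continuous in x.\<close>
    have "continuous_on (ball 0 a) (\<lambda>x. F (x, w) - Q (x, w) * ?P (x, w))"
      using w \<rho>
      by (intro continuous_intros continuous_on_compose2[OF contF] continuous_on_compose2[OF contQ]
          continuous_on_compose2[OF contP[of UNIV]]) auto
    then have "isCont (\<lambda>x. F (x, w) - Q (x, w) * ?P (x, w)) 0"
      using a(1) by (simp add: continuous_on_eq_continuous_at)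
    then have "((\<lambda>x. F (x, w) - Q (x, w) * ?P (x, w)) \<longlongrightarrow> F (0, w) - Q (0, w) * ?P (0, w)) (at 0)"
      by (simp add: isCont_def)
    moreover have "\<forall>\<^sub>F x in at 0. F (x, w) - Q (x, w) * ?P (x, w) = 0"
      unfolding eventually_at using eq_nonzero[OF _ _ w] a(1) by (intro exI[of _ a]) auto
    ultimately have "((\<lambda>x. 0) \<longlongrightarrow> F (0, w) - Q (0, w) * ?P (0, w)) (at (0::complex))"
      by (simp cong: tendsto_cong)
    then show ?thesis unfolding True by (metis LIM_const_eq eq_iff_diff_eq_0)
  qed (use eq_nonzero that in blast)
  have "Q holomorphic2_on (ball 0 a \<times> ball 0 \<rho>)"
  proof (rule holomorphic2_onI[OF _ contQ])
    show "open (ball (0::complex) a \<times> ball (0::complex) \<rho>)" by (intro open_Times) auto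
    fix x w assume "(x, w) \<in> ball (0::complex) a \<times> ball (0::complex) \<rho>"
    then have xw: "x \<in> ball 0 a" "w \<in> ball 0 \<rho>" by auto
    have "(\<lambda>x. Q (x, w)) holomorphic_on ball 0 a"
    proof (rule holomorphic_on_quotient_finite_zeros)
      show "continuous_on (ball 0 a) (\<lambda>x. Q (x, w))"
        using xw by (intro continuous_on_compose2[OF contQ] continuous_intros) auto
      show "(\<lambda>x. F (x, w)) holomorphic_on ball 0 a"
        unfolding holomorphic_on_def using xw \<rho> box
        by (intro ballI field_differentiable_at_within[OF holomorphic2_along_curve[OF F(1)]]) auto
      show "(\<lambda>x. ?P (x, w)) holomorphic_on ball 0 a"
        using a by (intro holomorphic_on_subset[OF conjugate_product_holomorphic_on_fst]) auto
      show "finite {x \<in> ball 0 a. ?P (x, w) = 0}"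
        unfolding a_def by (rule finite_conjugate_product_zeros_fst[OF y s(3,1)])
    qed (use eq xw in auto)
    then show "(\<lambda>x. Q (x, w)) field_differentiable at x"
      using xw holomorphic_on_imp_differentiable_at by blast
    have "(\<lambda>w. Q (x, w)) holomorphic_on ball 0 \<rho>"
    proof (rule holomorphic_on_quotient_finite_zeros)
      show "continuous_on (ball 0 \<rho>) (\<lambda>w. Q (x, w))"
        using xw by (intro continuous_on_compose2[OF contQ] continuous_intros) auto
      show "(\<lambda>w. F (x, w)) holomorphic_on ball 0 \<rho>"
        unfolding holomorphic_on_def using xw \<rho> box
        by (intro ballI field_differentiable_at_within[OF holomorphic2_along_curve[OF F(1)]]) auto
      show "(\<lambda>w. ?P (x, w)) holomorphic_on ball 0 \<rho>" by (rule conjugate_product_holomorphic_on_snd)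
      show "finite {w \<in> ball 0 \<rho>. ?P (x, w) = 0}"
        by (rule finite_subset[OF _ finite_conjugate_product_zeros_snd[of x]]) auto
    qed (use eq xw in auto)
    then show "(\<lambda>w. Q (x, w)) field_differentiable at w"
      using xw holomorphic_on_imp_differentiable_at by blast
  qed
  then show thesis using eq a \<rho> by (intro that[of a \<rho> Q]) auto
qed

end

section \<open>Comparing the order of the equation with the order of y\<close>

lemma has_order2_imp_upper_bound:
  assumes "has_order2 f n"
  obtains K where "K > 0" "\<forall>\<^sub>F z in nhds 0. norm (f z) \<le> K * norm z ^ n"
proof -
  obtain c K where K: "\<forall>\<^sub>F z in nhds 0. norm (f z - (\<Sum>i\<le>n. c i * fst z ^ i * snd z ^ (n - i))) \<le> K * norm z ^ Suc n"
    using assms unfolding has_order2_def by blast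
  define A where "A = (\<Sum>i\<le>n. norm (c i))"
  have "A \<ge> 0" by (simp add: A_def sum_nonneg)
  have form: "norm (\<Sum>i\<le>n. c i * fst z ^ i * snd z ^ (n - i)) \<le> A * norm z ^ n" for z :: "complex \<times> complex"
  proof -
    have "norm (c i * fst z ^ i * snd z ^ (n - i)) \<le> norm (c i) * norm z ^ n" if "i \<le> n" for i
    proof -
      have "norm (fst z) ^ i * norm (snd z) ^ (n - i) \<le> norm z ^ i * norm z ^ (n - i)"
        using norm_fst_le[of "fst z" "snd z"] norm_snd_le[of "snd z" "fst z"]
        by (intro mult_mono power_mono) auto
      also have "\<dots> = norm z ^ n" using that by (simp flip: power_add)
      finally show ?thesis by (simp add: norm_mult norm_power mult.assoc mult_left_mono)
    qed
    then have "norm (\<Sum>i\<le>n. c i * fst z ^ i * snd z ^ (n - i)) \<le> (\<Sum>i\<le>n. norm (c i) * norm z ^ n)"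
      by (intro sum_norm_le) auto
    then show ?thesis by (simp add: A_def sum_distrib_right)
  qed
  have "\<forall>\<^sub>F z in nhds (0::complex \<times> complex). norm z < 1"
    unfolding eventually_nhds_metric by (intro exI[of _ 1]) auto
  with K have "\<forall>\<^sub>F z in nhds 0. norm (f z) \<le> (A + \<bar>K\<bar> + 1) * norm z ^ n"
  proof eventually_elim
    case (elim z)
    have "K * norm z ^ Suc n \<le> \<bar>K\<bar> * norm z ^ n"
      using elim(2) power_decreasing[of n "Suc n" "norm z"] by (intro mult_mono) auto
    then have "norm (f z) \<le> \<bar>K\<bar> * norm z ^ n + A * norm z ^ n"
      using norm_triangle_sub[of "f z" "\<Sum>i\<le>n. c i * fst z ^ i * snd z ^ (n - i)"] elim(1) form[of z] by linarith
    also have "\<dots> \<le> (A + \<bar>K\<bar> + 1) * norm z ^ n" by (simp add: distrib_right)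
    finally show ?case .
  qed
  then show thesis using \<open>A \<ge> 0\<close> by (intro that[of "A + \<bar>K\<bar> + 1"]) auto
qed

text \<open>On the line w = 0 the product has n factors of size at least c |t|^m, where m = ord y,
  and |t|^(n m) = |x|^m. So along this line its order in x is at most m.\<close>

lemma conjugate_product_lower_bound:
  assumes "n > 0" "fps_conv_radius y > 0" "y \<noteq> 0"
  obtains c where "c > 0" "\<forall>\<^sub>F x in nhds 0. norm (conjugate_product n y (x, 0)) \<ge> c * norm x ^ subdegree y"
proof -
  obtain c d where cd: "c > 0" "d > 0" "\<And>t. norm t < d \<Longrightarrow> norm (eval_fps y t) \<ge> c * norm t ^ subdegree y"
    using has_fps_expansion_lower_bound[OF eval_fps_has_fps_expansion[OF assms(2)] assms(3)] by blast
  have fin: "finite {\<zeta>::complex. \<zeta> ^ n = 1}" using assms(1) finite_roots_unity[of n] by simp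
  have "norm (conjugate_product n y (x, 0)) \<ge> c ^ n * norm x ^ subdegree y" if x: "norm x < d ^ n" for x
  proof -
    define t where "t = nth_root n x"
    have t: "t ^ n = x" using nth_root_power[OF assms(1)] by (simp add: t_def)
    have "norm t < d" using norm_less_of_power_mem_ball[of t n d] x t cd(2) by simp
    have "c ^ n * norm x ^ subdegree y = (c * norm t ^ subdegree y) ^ n"
      by (simp add: power_mult_distrib norm_power flip: t power_mult) (simp add: mult.commute)
    also have "\<dots> = (\<Prod>\<zeta> | \<zeta> ^ n = (1::complex). c * norm t ^ subdegree y)"
      using card_roots_unity_eq[of n] assms(1) by simp
    also have "\<dots> \<le> (\<Prod>\<zeta> | \<zeta> ^ n = 1. norm (0 - eval_fps y (\<zeta> * t)))"
    proof (intro prod_mono conjI)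
      fix \<zeta> :: complex assume "\<zeta> \<in> {\<zeta>. \<zeta> ^ n = 1}"
      then have "norm \<zeta> = 1" using power_eq_1_iff[of \<zeta> n] assms(1) by auto
      then show "c * norm t ^ subdegree y \<le> norm (0 - eval_fps y (\<zeta> * t))"
        using cd(3)[of "\<zeta> * t"] \<open>norm t < d\<close> by (simp add: norm_mult)
    qed (use cd in auto)
    also have "\<dots> = norm (conjugate_product n y (x, 0))"
      unfolding conjugate_product_root[OF assms(1) t] by (simp only: prod_norm)
    finally show ?thesis .
  qed
  then have "\<forall>\<^sub>F x in nhds 0. norm (conjugate_product n y (x, 0)) \<ge> c ^ n * norm x ^ subdegree y"
    unfolding eventually_nhds_metric using cd(2) by (intro exI[of _ "d ^ n"]) auto
  then show thesis using cd(1) by (intro that[of "c ^ n"]) auto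
qed

lemma power_le_imp_exponent_le:
  fixes c K :: real
  assumes "\<forall>\<^sub>F x in nhds (0::complex). c * norm x ^ m \<le> K * norm x ^ n" "c > 0"
  shows "n \<le> m"
proof (rule ccontr)
  assume "\<not> n \<le> m"
  then have mn: "m < n" by simp
  obtain d where d: "d > 0" "\<And>x::complex. norm x < d \<Longrightarrow> c * norm x ^ m \<le> K * norm x ^ n"
    using assms(1) unfolding eventually_nhds_metric by auto
  \<comment> \<open>The last bound gives |K| |x| \<le> c / 2, against c \<le> |K| |x|; the bound 1
    allows the exponent n to be lowered to m + 1.\<close>
  define x where "x = complex_of_real (min (d / 2) (min 1 (c / (2 * (\<bar>K\<bar> + 1)))))"
  have x: "0 < norm x" "norm x < d" "norm x \<le> 1" "norm x \<le> c / (2 * (\<bar>K\<bar> + 1))"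
    using d(1) assms(2) by (auto simp: x_def)
  have "c * norm x ^ m \<le> K * norm x ^ n" using d(2) x by simp
  also have "\<dots> \<le> \<bar>K\<bar> * norm x ^ Suc m"
    using x mn power_decreasing[of "Suc m" n "norm x"] by (intro mult_mono) auto
  also have "\<dots> = (\<bar>K\<bar> * norm x) * norm x ^ m" by simp
  finally have "c \<le> \<bar>K\<bar> * norm x" using x(1) by simp
  also have "\<dots> \<le> (\<bar>K\<bar> + 1) * (c / (2 * (\<bar>K\<bar> + 1)))" using x by (intro mult_mono) auto
  also have "\<dots> = c / 2" by (simp add: field_simps)
  finally show False using assms(2) by simp
qed

text \<open>In the coordinates of the parametrization f becomes Q P with P the conjugate product. As
  P vanishes at 0, irreducibility makes Q a unit, so P inherits from f the bound by the n-th power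
  of the norm. On the line w = 0 this meets the lower bound by |x|^m with m = ord y.\<close>

lemma has_multiplicity_le_exponent:
  assumes mult: "has_multiplicity C n" and param: "parametrized_by C n y" and n: "n > 0"
    and C0: "0 \<in> C" and y: "y \<noteq> 0"
  shows "n \<le> subdegree y"
proof -
  obtain f where f: "irreducible_germ2 f" "\<forall>\<^sub>F z in nhds 0. z \<in> C \<longleftrightarrow> f z = 0" "has_order2 f n"
    using mult unfolding has_multiplicity_def branch_equation_def by blast
  obtain U0 where U0: "open U0" "0 \<in> U0" "f holomorphic2_on U0"
    using f(1) unfolding irreducible_germ2_def holomorphic_germ2_def by blast
  obtain W where W: "open W" "0 \<in> W" "\<And>z. z \<in> W \<Longrightarrow> z \<in> C \<longleftrightarrow> f z = 0"
    using f(2) unfolding eventually_nhds by blast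
  obtain \<phi> \<psi> U V r where U: "open U" "0 \<in> U" and V: "open V" "0 \<in> V" and \<phi>0: "\<phi> 0 = 0" "\<psi> 0 = 0"
    and inv: "\<And>z. z \<in> U \<Longrightarrow> \<psi> (\<phi> z) = z" "\<And>z. z \<in> V \<Longrightarrow> \<phi> (\<psi> z) = z" "\<phi> ` U = V" "\<psi> ` V = U"
    and cont: "continuous_on U \<phi>" "continuous_on V \<psi>"
    and hol: "(fst \<circ> \<phi>) holomorphic2_on U" "(snd \<circ> \<phi>) holomorphic2_on U"
      "(fst \<circ> \<psi>) holomorphic2_on V" "(snd \<circ> \<psi>) holomorphic2_on V"
    and r: "0 < r" "ereal r \<le> fps_conv_radius y" and y0: "eval_fps y 0 = 0"
    and inj: "inj_on (\<lambda>t. (t ^ n, eval_fps y t)) (ball 0 r)"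
    and contG: "continuous_on (ball 0 r) (\<lambda>t. (t ^ n, eval_fps y t))"
    and img: "\<phi> ` (C \<inter> U) = (\<lambda>t. (t ^ n, eval_fps y t)) ` ball 0 r"
    and GV: "\<And>t. t \<in> ball 0 r \<Longrightarrow> (t ^ n, eval_fps y t) \<in> V \<and> \<psi> (t ^ n, eval_fps y t) \<in> C \<inter> U"
    by (rule parametrized_byE[OF param n C0]) (rule that; assumption)
  have conv: "fps_conv_radius y > 0" using less_le_trans[OF _ r(2), of 0] r(1) by simp

  define N where "N = V \<inter> \<psi> -` U0"
  have N: "open N" "0 \<in> N"
    unfolding N_def using continuous_open_preimage[OF cont(2) V(1) U0(1)] V(2) \<phi>0 U0(2) by auto
  have F: "(f \<circ> \<psi>) holomorphic2_on N"
    by (rule holomorphic2_compose[OF U0(3)]) (use hol in \<open>auto simp: N_def intro: holomorphic2_on_subset\<close>)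
  have "continuous_on (ball 0 r) (\<lambda>t. \<psi> (t ^ n, eval_fps y t))"
    using GV by (intro continuous_on_compose2[OF cont(2) contG]) auto
  \<comment> \<open>Shrinks the disc so that the parametrized points fall where C is the zero set of
    f.\<close>
  then have "open (ball 0 r \<inter> (\<lambda>t. \<psi> (t ^ n, eval_fps y t)) -` W)"
    using W(1) by (intro continuous_open_preimage) auto
  moreover have "0 \<in> ball 0 r \<inter> (\<lambda>t. \<psi> (t ^ n, eval_fps y t)) -` W"
    using r(1) n y0 \<phi>0 W(2) by (simp add: zero_power flip: zero_prod_def)
  ultimately obtain s where s: "s > 0" "ball 0 s \<subseteq> ball 0 r \<inter> (\<lambda>t. \<psi> (t ^ n, eval_fps y t)) -` W"
    unfolding open_contains_ball by blast
  have "ball (0::complex) s \<subseteq> ball 0 r" using s(2) by blast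
  then have "s \<le> r" using s(1) unfolding ball_subset_ball_iff by auto
  then have s_conv: "ereal s \<le> fps_conv_radius y" using order_trans[OF _ r(2), of "ereal s"] by simp
  have inj_s: "inj_on (\<lambda>t. (t ^ n, eval_fps y t)) (ball 0 s)"
    using inj by (rule inj_on_subset) (use s in auto)
  have vanish: "(f \<circ> \<psi>) (t ^ n, eval_fps y t) = 0" if "t \<in> ball 0 s" for t
  proof -
    have "t \<in> ball 0 r" "\<psi> (t ^ n, eval_fps y t) \<in> W" using that s(2) by blast+
    then show ?thesis using GV[of t] W(3) by auto
  qed
  let ?P = "conjugate_product n y"
  obtain a \<rho> Q where a: "a > 0" "\<rho> > 0" "a \<le> s ^ n" and Q: "Q holomorphic2_on (ball 0 a \<times> ball 0 \<rho>)"
    and FQP: "\<And>p. p \<in> ball 0 a \<times> ball 0 \<rho> \<Longrightarrow> (f \<circ> \<psi>) p = Q p * ?P p"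
    using branch_divides_vanishing_function[OF n s(1) s_conv inj_s y y0 F N vanish] by blast
  define B where "B = ball (0::complex) a \<times> ball (0::complex) \<rho>"
  have B: "open B" "0 \<in> B" using a by (auto simp: B_def zero_prod_def intro: open_Times)
  have P: "?P holomorphic2_on B"
    using conjugate_product_holomorphic2_on[OF n s(1) s_conv]
    by (rule holomorphic2_on_subset) (use a in \<open>auto simp: B_def\<close>)

  define M where "M = U \<inter> \<phi> -` B"
  have M: "open M" "0 \<in> M"
    unfolding M_def using continuous_open_preimage[OF cont(1) U(1) B(1)] U(2) \<phi>0 B(2) by auto
  have "M \<subseteq> U" "\<phi> ` M \<subseteq> B" by (auto simp: M_def)
  note compose_M = holomorphic2_compose[OF _ holomorphic2_on_subset[OF hol(1) this(1)]
      holomorphic2_on_subset[OF hol(2) this(1)] this(2)]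
  have "(Q \<circ> \<phi>) holomorphic2_on M" "(?P \<circ> \<phi>) holomorphic2_on M"
    using compose_M[OF Q[folded B_def]] compose_M[OF P] by blast+
  then have "holomorphic_germ2 (Q \<circ> \<phi>)" "holomorphic_germ2 (?P \<circ> \<phi>)"
    unfolding holomorphic_germ2_def using M by blast+
  moreover have "\<forall>\<^sub>F z in nhds 0. f z = (Q \<circ> \<phi>) z * (?P \<circ> \<phi>) z"
  proof -
    have "f z = (Q \<circ> \<phi>) z * (?P \<circ> \<phi>) z" if "z \<in> M" for z
      using that FQP[of "\<phi> z"] inv(1)[of z] by (auto simp: M_def B_def)
    then show ?thesis unfolding eventually_nhds using M by blast
  qed
  ultimately have "(Q \<circ> \<phi>) 0 \<noteq> 0 \<or> (?P \<circ> \<phi>) 0 \<noteq> 0"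
    using f(1) unfolding irreducible_germ2_def by blast
  moreover have "?P 0 = 0"
    using conjugate_product_eq_0_iff[OF n, of y 0 0] y0 n by (auto simp: zero_prod_def intro!: exI[of _ 0])
  ultimately have Q0: "Q 0 \<noteq> 0" by (simp add: \<phi>0)

  obtain K where K: "K > 0" "\<forall>\<^sub>F z in nhds 0. norm (f z) \<le> K * norm z ^ n"
    using has_order2_imp_upper_bound[OF f(3)] by blast
  have "isCont \<psi> 0" using cont(2) V by (simp add: continuous_on_eq_continuous_at)
  then have "filterlim \<psi> (nhds 0) (nhds 0)"
    using \<phi>0 by (simp add: isCont_def tendsto_nhds_iff)
  with K(2) have 1: "\<forall>\<^sub>F p in nhds 0. norm (f (\<psi> p)) \<le> K * norm (\<psi> p) ^ n"
    by (rule eventually_compose_filterlim)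
  obtain b L where L: "b > 0" "L > 0" "ball 0 b \<subseteq> V"
    "\<And>p q. p \<in> ball 0 b \<Longrightarrow> q \<in> ball 0 b \<Longrightarrow> norm (\<psi> p - \<psi> q) \<le> L * norm (p - q)"
    using holomorphic2_pair_imp_locally_lipschitz[OF hol(3,4) V] by blast
  have 2: "\<forall>\<^sub>F p in nhds 0. norm (\<psi> p) \<le> L * norm p"
    unfolding eventually_nhds_metric using L(1) L(4)[of _ 0] \<phi>0 by (intro exI[of _ b]) auto
  have "isCont Q 0"
    using holomorphic2_imp_continuous_on[OF Q[folded B_def]] B by (simp add: continuous_on_eq_continuous_at)
  then have "filterlim Q (nhds (Q 0)) (nhds 0)" by (simp add: isCont_def tendsto_nhds_iff)
  then have 3: "\<forall>\<^sub>F p in nhds 0. dist (Q p) (Q 0) < norm (Q 0) / 2"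
    by (rule tendstoD) (use Q0 in simp)
  have 4: "\<forall>\<^sub>F p in nhds 0. p \<in> B" using B by (rule eventually_nhds_in_open)
  define K2 where "K2 = K * L ^ n * (2 / norm (Q 0))"
  from 1 2 3 4 have "\<forall>\<^sub>F p in nhds 0. norm (?P p) \<le> K2 * norm p ^ n"
  proof eventually_elim
    case (elim p)
    have "norm (Q 0) / 2 \<le> norm (Q p)"
      using elim(3) norm_triangle_ineq2[of "Q 0" "Q p"] by (simp add: dist_norm norm_minus_commute)
    then have "norm (Q 0) / 2 * norm (?P p) \<le> norm (Q p) * norm (?P p)" by (rule mult_right_mono) simp
    also have "\<dots> = norm (f (\<psi> p))" using FQP[of p] elim(4) by (simp add: B_def norm_mult)
    also have "\<dots> \<le> K * norm (\<psi> p) ^ n" by (rule elim(1))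
    also have "\<dots> \<le> K * (L * norm p) ^ n" using elim(2) K(1) by (intro mult_left_mono power_mono) auto
    finally show ?case using Q0 by (simp add: K2_def field_simps)
  qed
  moreover have "filterlim (\<lambda>x::complex. (x, 0::complex)) (nhds 0) (nhds 0)"
    unfolding zero_prod_def by (intro tendsto_intros filterlim_ident)
  ultimately have upper: "\<forall>\<^sub>F x in nhds 0. norm (?P (x, 0)) \<le> K2 * norm (x, 0::complex) ^ n"
    by (rule eventually_compose_filterlim)
  obtain c where c: "c > 0" "\<forall>\<^sub>F x in nhds 0. norm (?P (x, 0)) \<ge> c * norm x ^ subdegree y"
    using conjugate_product_lower_bound[OF n conv y] by blast
  from upper c(2) have "\<forall>\<^sub>F x in nhds (0::complex). c * norm x ^ subdegree y \<le> K2 * norm x ^ n"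
    by eventually_elim (simp add: norm_Pair)
  then show ?thesis using c(1) by (rule power_le_imp_exponent_le)
qed

section \<open>Conclusion\<close>

lemma plane_branch_imp_zero_mem:
  assumes "plane_branch C"
  shows "0 \<in> C"
proof -
  obtain f :: "complex \<times> complex \<Rightarrow> complex"
    where "f 0 = 0" "\<forall>\<^sub>F z in nhds 0. z \<in> C \<longleftrightarrow> f z = 0"
    using assms unfolding plane_branch_def branch_equation_def irreducible_germ2_def by blast
  then show ?thesis by (auto dest: eventually_nhds_x_imp_x)
qed

text \<open>Order 0 would make f tend to a nonzero constant at the origin, whereas f(0) = 0.\<close>

lemma has_multiplicity_pos:
  assumes "has_multiplicity C n"
  shows "n > 0"
proof (rule ccontr)
  assume "\<not> n > 0"
  then obtain f where f: "f 0 = 0" "has_order2 f 0"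
    using assms unfolding has_multiplicity_def branch_equation_def irreducible_germ2_def by auto
  then obtain c :: "nat \<Rightarrow> complex" and K where "c 0 \<noteq> 0"
    "\<forall>\<^sub>F z in nhds 0. norm (f z - c 0) \<le> K * norm z"
    unfolding has_order2_def by auto
  then show False using f(1) by (auto dest: eventually_nhds_x_imp_x)
qed

text \<open>Gives all branches one shape. Since n does not divide ord y, ord y is the least exponent
  that is not a multiple of n, so the second entry of \<beta> is just the first step of
  \<open>further_exponents\<close> started at n; a smooth branch is its stopping case.\<close>

lemma characteristic_exponentsE:
  assumes "plane_branch C" "characteristic_exponents C \<beta>"
  obtains n y bs \<gamma> r L where "n > 0" "fps_conv_radius y > 0" "\<And>k. fps_nth y k \<noteq> 0 \<Longrightarrow> n \<le> k"
    "branch_chart C n y \<gamma> r L" "further_exponents y n bs" "\<beta> = n # bs"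
proof -
  obtain n y where mult: "has_multiplicity C n" and param: "parametrized_by C n y" and y: "y \<noteq> 0"
    and \<beta>: "if n = 1 then \<beta> = [1] else \<not> n dvd subdegree y \<and>
      (\<exists>bs. further_exponents y (gcd n (subdegree y)) bs \<and> \<beta> = n # subdegree y # bs)"
    using assms(2) unfolding characteristic_exponents_def by blast
  have n: "n > 0" using mult by (rule has_multiplicity_pos)
  have C0: "0 \<in> C" using assms(1) by (rule plane_branch_imp_zero_mem)
  have le: "n \<le> subdegree y" by (rule has_multiplicity_le_exponent[OF mult param n C0 y])
  have supp: "subdegree y \<le> k" if "fps_nth y k \<noteq> 0" for k using that by (rule subdegree_leI)
  obtain r0 where "0 < r0" "ereal r0 \<le> fps_conv_radius y"
    using param unfolding parametrized_by_def by blast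
  then have conv: "fps_conv_radius y > 0" using less_le_trans[of 0 "ereal r0"] by simp
  obtain \<gamma> r L where chart: "branch_chart C n y \<gamma> r L"
    using parametrized_by_imp_branch_chart[OF param n C0] by blast
  have "\<exists>bs. further_exponents y n bs \<and> \<beta> = n # bs"
  proof (cases "n = 1")
    case True
    then show ?thesis using \<beta> further_exponents.stop by auto
  next
    case False
    then obtain bs where bs: "\<not> n dvd subdegree y" "further_exponents y (gcd n (subdegree y)) bs"
      "\<beta> = n # subdegree y # bs" using \<beta> by auto
    have "further_exponents y n (subdegree y # bs)"
      using False n y supp bs by (intro further_exponents.step) auto
    then show ?thesis using bs(3) by blast
  qed
  then obtain bs where "further_exponents y n bs" "\<beta> = n # bs" by blast
  moreover have "n \<le> k" if "fps_nth y k \<noteq> 0" for k using order_trans[OF le supp[OF that]] .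
  ultimately show thesis by (intro that[OF n conv _ chart])
qed

lemma holder_homeomorphic_sym:
  assumes "holder_homeomorphic \<alpha> X a Y b" "a \<in> X"
  shows "holder_homeomorphic \<alpha> Y b X a"
proof -
  obtain U V f g where *: "open U" "a \<in> U" "open V" "b \<in> V" "homeomorphism (X \<inter> U) (Y \<inter> V) f g"
    "f a = b" "holder_on \<alpha> (X \<inter> U) f" "holder_on \<alpha> (Y \<inter> V) g"
    using assms(1) unfolding holder_homeomorphic_def by blast
  then have "g b = a" using assms(2) by (auto simp: homeomorphism_def)
  then show ?thesis
    unfolding holder_homeomorphic_def using * homeomorphism_symD[OF *(5)] by blast
qed

theorem theorem4p1:
  fixes C C' :: "(complex \<times> complex) set" and \<beta> \<beta>' :: "nat list"
  assumes "plane_branch C" and "plane_branch C'"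
    and "characteristic_exponents C \<beta>" and "characteristic_exponents C' \<beta>'"
    and "\<beta> \<noteq> \<beta>'"
  shows "(\<exists>\<alpha>. 0 < \<alpha> \<and> \<alpha> < 1 \<and> \<not> holder_homeomorphic \<alpha> C 0 C' 0) \<and>
         \<not> bilipschitz_homeomorphic C 0 C' 0"
proof -
  obtain n y bs \<gamma> r L where C: "n > 0" "fps_conv_radius y > 0" "\<And>k. fps_nth y k \<noteq> 0 \<Longrightarrow> n \<le> k"
    "branch_chart C n y \<gamma> r L" "further_exponents y n bs" "\<beta> = n # bs"
    using assms(1,3) by (rule characteristic_exponentsE) blast
  obtain n' y' bs' \<gamma>' r' L' where C': "n' > 0" "fps_conv_radius y' > 0" "\<And>k. fps_nth y' k \<noteq> 0 \<Longrightarrow> n' \<le> k"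
    "branch_chart C' n' y' \<gamma>' r' L'" "further_exponents y' n' bs'" "\<beta>' = n' # bs'"
    using assms(2,4) by (rule characteristic_exponentsE) blast
  obtain q where q: "q > 1" "contact_gcd n y q \<noteq> contact_gcd n' y' q"
    using characteristic_exponents_eqI[OF C(1) C'(1) _ C(3) C'(3) C(5) C'(5)] assms(5) C(6) C'(6) by blast
  \<comment> \<open>No bound \<alpha> < 1 is imposed, so \<alpha> = 1 is covered and the
    bi-Lipschitz claim comes from the same statement.\<close>
  have not_hom: "\<not> holder_homeomorphic \<alpha> C 0 C' 0"
    if \<alpha>: "\<alpha> > 0" "\<alpha>\<^sup>2 * q > 1" "contact_gcd n y (\<alpha>\<^sup>2 * q) = contact_gcd n y q"
      "contact_gcd n' y' (\<alpha>\<^sup>2 * q) = contact_gcd n' y' q" for \<alpha>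
  proof
    assume hom: "holder_homeomorphic \<alpha> C 0 C' 0"
    then have hom': "holder_homeomorphic \<alpha> C' 0 C 0"
      by (rule holder_homeomorphic_sym) (rule plane_branch_imp_zero_mem[OF assms(1)])
    have "contact_gcd n y q \<le> contact_gcd n' y' q" "contact_gcd n' y' q \<le> contact_gcd n y q"
      using holder_homeomorphic_imp_contact_gcd_le[OF C(4) C'(4) C(2,1,3) C'(2,1,3) \<alpha>(1,2) hom]
        holder_homeomorphic_imp_contact_gcd_le[OF C'(4) C(4) C'(2,1,3) C(2,1,3) \<alpha>(1,2) hom'] \<alpha>(3,4)
      by simp_all
    then show False using q(2) by simp
  qed
  have "\<forall>\<^sub>F x in at_left q. contact_gcd n y x = contact_gcd n y q \<and>
      contact_gcd n' y' x = contact_gcd n' y' q \<and> x \<in> {1<..<q}"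
    using contact_gcd_left_continuous[OF C(1)] contact_gcd_left_continuous[OF C'(1)]
      eventually_at_left_real[OF q(1)]
    by eventually_elim simp
  then obtain x where x: "contact_gcd n y x = contact_gcd n y q" "contact_gcd n' y' x = contact_gcd n' y' q"
    "1 < x" "x < q"
    using eventually_happens[of _ "at_left q"] by (auto simp: trivial_limit_at_left_real)
  \<comment> \<open>Makes \<alpha>^2 q equal to x, a value below q at which both gcd functions still
    have their values at q.\<close>
  define \<alpha> where "\<alpha> = sqrt (x / q)"
  have \<alpha>: "0 < \<alpha>" "\<alpha> < 1" "\<alpha>\<^sup>2 * q = x" using x q(1) by (auto simp: \<alpha>_def)
  have "\<not> holder_homeomorphic \<alpha> C 0 C' 0" using \<alpha> x by (intro not_hom) auto
  moreover have "\<not> bilipschitz_homeomorphic C 0 C' 0"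
    unfolding bilipschitz_homeomorphic_def using q(1) by (intro not_hom) auto
  ultimately show ?thesis using \<alpha> by blast
qed

end
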